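(* For all $m_1,m_1',m_2,m_2'\in\mathbb{Q}_{>0}$, $$\rho^\mu_{m_1',m_2'}\circ\varrho^{\mu,*}_{m_1,m_1'}=\varrho^{\mu,\sqcup\!\sqcup}_{m_2,m_2'}\circ\rho^\mu_{m_1,m_2}$$ as maps $\mathbb{C}[T]\to\mathbb{C}[T]$ (in particular on $\mathcal{Z}^\mu[T]$).
   Context: Fix $\mu\in\mathbb{C}$, $\mathrm{Re}(\mu)>0$; $\mathbb{Q}[\mu]\subset\mathbb{C}$ the ring generated by $\mu$. $H(x)=\int_0^1\frac{1-t^x}{1-t}dt$; for $a,b\in\mathbb{Q}_{>0}$, $c_{a,b}=H(b/\mu-1)-H(a/\mu-1)$, and $\varrho^{\mu,*}_{a,b}=\varrho^{\mu,\sqcup\!\sqcup}_{a,b}$ is the $\mathbb{C}$-linear map $\mathbb{C}[T]\to\mathbb{C}[T]$, $T^s\mapsto(T+c_{a,b})^s$. Bi-indices $(\mathbf{k};\mathbf{m})\in\mathbb{N}^r\times\mathbb{Q}^r$: positive if all $m_i>0$, admissible if positive and $k_r>1$; $\zeta^{\mu}(\mathbf{k};\mathbf{m})=\sum_{0\le n_1\le\cdots\le n_r}\mu^r\prod_i(n_i\mu+m_i)^{-k_i}$. Special triples $(\mathbf{k};\mathbf{m};\tilde{\mathbf{m}})$: $\mathbf{k}=(k_1,\dots,k_{r-1},1)$, $\tilde{\mathbf{m}}$ equals $\mathbf{m}$ except last entry $\tilde m_r\ne m_r$, entries in $\mathbb{Q}_{>0}$; $\mathcal{D}^{\mu}(\mathbf{k};\mathbf{m};\tilde{\mathbf{m}})=(\tilde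 m_r-m_r)\sum\frac{\mu^r}{\prod_{i<r}(n_i\mu+m_i)^{k_i}(n_r\mu+m_r)(n_r\mu+\tilde m_r)}$ (sum over $0\le n_1\le\dots\le n_r$). $\mathcal{Z}^\mu$ = $\mathbb{Q}[\mu]$-span of $1$ and these values. $Y=\{y_{k,m}:k\in\mathbb{N},m\in\mathbb{Q}_{>0}\}$, $\mathbb{Q}[\mu]\langle Y\rangle$ the free noncommutative algebra on words, $y_{\mathbf{k};\mathbf{m}}=y_{k_1,m_1}\cdots y_{k_r,m_r}$; $\odot$ on letters: $y_{k_1,m}\odot y_{k_2,m}=y_{k_1+k_2,m}$, and for $m_1\neq m_2$, $y_{k_1,m_1}\odot y_{k_2,m_2}=\sum_{i\le k_1}a_iy_{i,m_1}+\sum_{j\le k_2}b_jy_{j,m_2}$ where $\frac{1}{(x+m_1)^{k_1}(x+m_2)^{k_2}}=\sum\frac{a_i}{(x+m_1)^i}+\sum\frac{b_j}{(x+m_2)^j}$; $\ast_\mu$ bilinear with $1\ast_\mu w=w\ast_\mu 1=w$, $ux\ast_\mu vy=(u\ast_\mu vy)x+(ux\ast_\mu v)y-\mu(u\ast_\mu v)(x\odot y)$. $\mathbb{Q}[\mu]\langle Y\rangle^0$ = span of $1$, admissible $y_{\mathbf{k};\mathbf{m}}$, and $y_{\mathbf{k};\mathbf{m}}-y_{\mathbf{k};\tilde{\mathbf{m}}}$ (special triples); $\zeta^\mu_*(w)=\lim_{M\to\infty}\zeta^\mu_{*,M}(w)$ on it, $\zeta^\mu_{*,M}(y_{\mathbf{k};\mathbf{m}})=\sum_{0\le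 n_1\le\dots\le n_r\le M}\mu^r\prod(n_i\mu+m_i)^{-k_i}$. $\zeta^{\mu,T}_{*,m}$ ($m\in\mathbb{Q}_{>0}$): the unique $\mathbb{Q}[\mu]$-linear map $\mathbb{Q}[\mu]\langle Y\rangle\to\mathcal{Z}^\mu[T]$ extending $\zeta^\mu_*$, with $y_{1,m}\mapsto T$, multiplicative for $\ast_\mu$. $X^\mu=\{x\}\cup\{y^\mu_l:l\in\mathbb{Q}\}$; shuffle: $1\sqcup\!\sqcup w=w\sqcup\!\sqcup 1=w$, $w_1u\sqcup\!\sqcup w_2v=(w_1\sqcup\!\sqcup w_2v)u+(w_1u\sqcup\!\sqcup w_2)v$. $(y,x)^\mu_{\mathbf{k};\mathbf{m}}=y^\mu_{m_1}x^{k_1-1}y^\mu_{m_2-m_1}x^{k_2-1}\cdots y^\mu_{m_r-m_{r-1}}x^{k_r-1}$. $\mathbb{Q}[\mu]\langle X^\mu\rangle^1$ = span of $(y,x)^\mu_{\mathbf{k};\mathbf{m}}$, $(\mathbf{k};\mathbf{m})$ positive (incl. $1$); $\mathbb{Q}[\mu]\langle X^\mu\rangle^0$ = span of $1$, admissible $(y,x)^\mu_{\mathbf{k};\mathbf{m}}$ and $(y,x)^\mu_{\mathbf{k};\mathbf{m}}-(y,x)^\mu_{\mathbf{k};\tilde{\mathbf{m}}}$; $\zeta^\mu_{\sqcup\!\sqcup}$ linear on it with values $1,\zeta^\mu(\mathbf{k};\mathbf{m}),\mathcal{D}^\mu(\mathbf{k};\mathbf{m};\tilde{\mathbf{m}})$.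 $\zeta^{\mu,T}_{\sqcup\!\sqcup,m}$: the unique $\mathbb{Q}[\mu]$-linear map $\mathbb{Q}[\mu]\langle X^\mu\rangle^1\to\mathcal{Z}^\mu[T]$ extending $\zeta^\mu_{\sqcup\!\sqcup}$, with $y^\mu_m\mapsto T$, multiplicative for $\sqcup\!\sqcup$. $\varphi_\mu$: linear bijection $y_{\mathbf{k};\mathbf{m}}\mapsto(y,x)^\mu_{\mathbf{k};\mathbf{m}}$. For $a,b\in\mathbb{Q}_{>0}$, $\rho^\mu_{a,b}$ is the unique $\mathbb{C}$-linear map $\mathbb{C}[T]\to\mathbb{C}[T]$ with $\zeta^{\mu,T}_{\sqcup\!\sqcup,b}(\varphi_\mu(w))=\rho^\mu_{a,b}(\zeta^{\mu,T}_{*,a}(w))$ for all $w\in\mathbb{Q}[\mu]\langle Y\rangle$. *)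

theory Defs
  imports
    "HOL-Analysis.Analysis"
    "HOL-Library.Poly_Mapping"
    "HOL-Computational_Algebra.Polynomial"
begin

definition Qmu :: "complex \<Rightarrow> complex set" where
  "Qmu \<mu> = range (\<lambda>p :: rat poly. poly (map_poly of_rat p) \<mu>)"

text \<open>Noncommutative polynomials with complex coefficients: finitely supported functions on words.
  The \<open>\<rat>[\<mu>]\<close>-algebras below are carved out of this type as sets.\<close>

type_synonym 'a ncpoly = "'a list \<Rightarrow>\<^sub>0 complex"

definition word :: "'a list \<Rightarrow> 'a ncpoly" where
  "word w = Poly_Mapping.single w 1"

definition scale :: "complex \<Rightarrow> 'a ncpoly \<Rightarrow> 'a ncpoly" where
  "scale c p = Poly_Mapping.map ((*) c) p"

definition lin_ext :: "('a list \<Rightarrow> 'b ncpoly) \<Rightarrow> 'a ncpoly \<Rightarrow> 'b ncpoly" where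
  "lin_ext f p = (\<Sum>w\<in>Poly_Mapping.keys p. scale (Poly_Mapping.lookup p w) (f w))"

definition bilin_ext ::
  "('a list \<Rightarrow> 'a list \<Rightarrow> 'a ncpoly) \<Rightarrow> 'a ncpoly \<Rightarrow> 'a ncpoly \<Rightarrow> 'a ncpoly" where
  "bilin_ext f p q = lin_ext (\<lambda>u. lin_ext (f u) q) p"

definition concat_prod :: "'a ncpoly \<Rightarrow> 'a ncpoly \<Rightarrow> 'a ncpoly" where
  "concat_prod = bilin_ext (\<lambda>u v. word (u @ v))"

definition span_over ::
  "complex set \<Rightarrow> (complex \<Rightarrow> 'v \<Rightarrow> 'v) \<Rightarrow> 'v set \<Rightarrow> 'v::comm_monoid_add set" where
  "span_over R sc S = {\<Sum>v\<in>F. sc (c v) v | F c. finite F \<and> F \<subseteq> S \<and> c ` F \<subseteq> R}"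

definition linear_over ::
  "complex set \<Rightarrow> (complex \<Rightarrow> 'v \<Rightarrow> 'v) \<Rightarrow> (complex \<Rightarrow> 'w \<Rightarrow> 'w) \<Rightarrow> 'v set
    \<Rightarrow> ('v::plus \<Rightarrow> 'w::plus) \<Rightarrow> bool" where
  "linear_over R sc sc' V f \<longleftrightarrow>
     (\<forall>u\<in>V. \<forall>v\<in>V. f (u + v) = f u + f v) \<and>
     (\<forall>c\<in>R. \<forall>v\<in>V. f (sc c v) = sc' c (f v))"

text \<open>``The unique map such that \<open>P\<close>''; the zero map is only a junk value for the case that \<open>P\<close>
  fails to determine a map uniquely.\<close>

definition the_map :: "(('v \<Rightarrow> 'w::zero) \<Rightarrow> bool) \<Rightarrow> 'v \<Rightarrow> 'w" where
  "the_map P = (if \<exists>!f. P f then THE f. P f else (\<lambda>_. 0))"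

text \<open>A bi-index \<open>(k\<^sub>1,\<dots>,k\<^sub>r; m\<^sub>1,\<dots>,m\<^sub>r)\<close> is the list of the pairs \<open>(k\<^sub>i, m\<^sub>i)\<close>; a letter
  \<open>y\<^bsub>k,m\<^esub>\<close> is the pair \<open>(k, m)\<close>, so the same list is the word \<open>y\<^bsub>k;m\<^esub>\<close>. The entries \<open>k\<^sub>i\<close> range over
  the positive integers.\<close>

type_synonym yletter = "nat \<times> rat"
type_synonym bi_index = "yletter list"

definition positive :: "bi_index \<Rightarrow> bool" where
  "positive w \<longleftrightarrow> (\<forall>(k, m)\<in>set w. k \<ge> 1 \<and> m > 0)"

definition admissible :: "bi_index \<Rightarrow> bool" where
  "admissible w \<longleftrightarrow> positive w \<and> w \<noteq> [] \<and> fst (last w) > 1"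

text \<open>\<open>special p m m'\<close> stands for the special triple whose two bi-indices are \<open>p @ [(1, m)]\<close> and
  \<open>p @ [(1, m')]\<close>.\<close>

definition special :: "bi_index \<Rightarrow> rat \<Rightarrow> rat \<Rightarrow> bool" where
  "special p m m' \<longleftrightarrow> positive p \<and> m > 0 \<and> m' > 0 \<and> m \<noteq> m'"

definition chains :: "nat \<Rightarrow> nat list set" where
  "chains r = {ns. length ns = r \<and> sorted ns}"

definition zeta_term :: "complex \<Rightarrow> bi_index \<Rightarrow> nat list \<Rightarrow> complex" where
  "zeta_term \<mu> w ns = \<mu> ^ length w *
     (\<Prod>i<length w. 1 / (of_nat (ns ! i) * \<mu> + of_rat (snd (w ! i))) ^ fst (w ! i))"

definition zeta :: "complex \<Rightarrow> bi_index \<Rightarrow> complex" where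
  "zeta \<mu> w = (\<Sum>\<^sub>\<infinity>ns\<in>chains (length w). zeta_term \<mu> w ns)"

definition zeta_diff :: "complex \<Rightarrow> bi_index \<Rightarrow> rat \<Rightarrow> rat \<Rightarrow> complex" where
  "zeta_diff \<mu> p m m' = of_rat (m' - m) *
     (\<Sum>\<^sub>\<infinity>ns\<in>chains (Suc (length p)).
        \<mu> ^ Suc (length p) /
        ((\<Prod>i<length p. (of_nat (ns ! i) * \<mu> + of_rat (snd (p ! i))) ^ fst (p ! i)) *
         (of_nat (ns ! length p) * \<mu> + of_rat m) *
         (of_nat (ns ! length p) * \<mu> + of_rat m')))"

definition Zmu :: "complex \<Rightarrow> complex set" where
  "Zmu \<mu> = span_over (Qmu \<mu>) (*)
     ({1} \<union> {zeta \<mu> w | w. admissible w} \<union> {zeta_diff \<mu> p m m' | p m m'. special p m m'})"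

definition ZmuT :: "complex \<Rightarrow> complex poly set" where
  "ZmuT \<mu> = {p. \<forall>i. coeff p i \<in> Zmu \<mu>}"

definition QY :: "complex \<Rightarrow> yletter ncpoly set" where
  "QY \<mu> = {p. (\<forall>w. Poly_Mapping.lookup p w \<in> Qmu \<mu>) \<and> (\<forall>w\<in>Poly_Mapping.keys p. positive w)}"

definition partial_fraction ::
  "nat \<Rightarrow> rat \<Rightarrow> nat \<Rightarrow> rat \<Rightarrow> (nat \<Rightarrow> rat) \<times> (nat \<Rightarrow> rat)" where
  "partial_fraction k1 m1 k2 m2 = (THE (a, b).
     (\<forall>i. i \<notin> {1..k1} \<longrightarrow> a i = 0) \<and> (\<forall>j. j \<notin> {1..k2} \<longrightarrow> b j = 0) \<and>
     (\<forall>x. x \<noteq> - m1 \<and> x \<noteq> - m2 \<longrightarrow>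
        1 / ((x + m1) ^ k1 * (x + m2) ^ k2) =
        (\<Sum>i=1..k1. a i / (x + m1) ^ i) + (\<Sum>j=1..k2. b j / (x + m2) ^ j)))"

definition odot :: "yletter \<Rightarrow> yletter \<Rightarrow> yletter ncpoly" where
  "odot = (\<lambda>(k1, m1) (k2, m2).
     if m1 = m2 then word [(k1 + k2, m1)]
     else let (a, b) = partial_fraction k1 m1 k2 m2 in
       (\<Sum>i=1..k1. scale (of_rat (a i)) (word [(i, m1)])) +
       (\<Sum>j=1..k2. scale (of_rat (b j)) (word [(j, m2)])))"

text \<open>The products \<open>*\<^sub>\<mu>\<close> and shuffle recurse on the last letters, so the auxiliary functions take
  their arguments reversed (their values are not reversed).\<close>

fun stuffle_rev :: "complex \<Rightarrow> yletter list \<Rightarrow> yletter list \<Rightarrow> yletter ncpoly" where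
  "stuffle_rev \<mu> [] v = word (rev v)"
| "stuffle_rev \<mu> u [] = word (rev u)"
| "stuffle_rev \<mu> (x # u) (y # v) =
     concat_prod (stuffle_rev \<mu> u (y # v)) (word [x]) +
     concat_prod (stuffle_rev \<mu> (x # u) v) (word [y]) -
     scale \<mu> (concat_prod (stuffle_rev \<mu> u v) (odot x y))"

definition stuffle :: "complex \<Rightarrow> yletter ncpoly \<Rightarrow> yletter ncpoly \<Rightarrow> yletter ncpoly" where
  "stuffle \<mu> = bilin_ext (\<lambda>u v. stuffle_rev \<mu> (rev u) (rev v))"

definition QY0 :: "complex \<Rightarrow> yletter ncpoly set" where
  "QY0 \<mu> = span_over (Qmu \<mu>) scale
     ({word []} \<union> {word w | w. admissible w} \<union>
      {word (p @ [(1, m)]) - word (p @ [(1, m')]) | p m m'. special p m m'})"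

definition zeta_trunc :: "complex \<Rightarrow> nat \<Rightarrow> yletter ncpoly \<Rightarrow> complex" where
  "zeta_trunc \<mu> M p = (\<Sum>w\<in>Poly_Mapping.keys p. Poly_Mapping.lookup p w *
     (\<Sum>ns\<in>{ns\<in>chains (length w). set ns \<subseteq> {..M}}. zeta_term \<mu> w ns))"

definition zeta_star :: "complex \<Rightarrow> yletter ncpoly \<Rightarrow> complex" where
  "zeta_star \<mu> p = lim (\<lambda>M. zeta_trunc \<mu> M p)"

text \<open>In \<open>complex poly\<close> the variable \<open>T\<close> is \<open>[:0, 1:]\<close>.\<close>

definition zeta_star_T :: "complex \<Rightarrow> rat \<Rightarrow> yletter ncpoly \<Rightarrow> complex poly" where
  "zeta_star_T \<mu> m = the_map (\<lambda>f.
     f \<in> QY \<mu> \<rightarrow>\<^sub>E ZmuT \<mu> \<and>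
     linear_over (Qmu \<mu>) scale smult (QY \<mu>) f \<and>
     (\<forall>w\<in>QY0 \<mu>. f w = [:zeta_star \<mu> w:]) \<and>
     f (word [(1, m)]) = [:0, 1:] \<and>
     (\<forall>u\<in>QY \<mu>. \<forall>v\<in>QY \<mu>. f (stuffle \<mu> u v) = f u * f v))"

datatype xletter = X | Y rat

fun shuffle_rev :: "xletter list \<Rightarrow> xletter list \<Rightarrow> xletter ncpoly" where
  "shuffle_rev [] v = word (rev v)"
| "shuffle_rev u [] = word (rev u)"
| "shuffle_rev (x # u) (y # v) =
     concat_prod (shuffle_rev u (y # v)) (word [x]) +
     concat_prod (shuffle_rev (x # u) v) (word [y])"

definition shuffle :: "xletter ncpoly \<Rightarrow> xletter ncpoly \<Rightarrow> xletter ncpoly" where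
  "shuffle = bilin_ext (\<lambda>u v. shuffle_rev (rev u) (rev v))"

text \<open>The first argument of \<open>yx_from\<close> is the preceding entry \<open>m\<^bsub>i-1\<^esub>\<close>, with \<open>m\<^sub>0 = 0\<close>.\<close>

fun yx_from :: "rat \<Rightarrow> bi_index \<Rightarrow> xletter list" where
  "yx_from m' [] = []"
| "yx_from m' ((k, m) # w) = Y (m - m') # replicate (k - 1) X @ yx_from m w"

definition yx :: "bi_index \<Rightarrow> xletter ncpoly" where
  "yx w = word (yx_from 0 w)"

definition QX1 :: "complex \<Rightarrow> xletter ncpoly set" where
  "QX1 \<mu> = span_over (Qmu \<mu>) scale {yx w | w. positive w}"

definition QX0 :: "complex \<Rightarrow> xletter ncpoly set" where
  "QX0 \<mu> = span_over (Qmu \<mu>) scale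
     ({word []} \<union> {yx w | w. admissible w} \<union>
      {yx (p @ [(1, m)]) - yx (p @ [(1, m')]) | p m m'. special p m m'})"

definition zeta_sh :: "complex \<Rightarrow> xletter ncpoly \<Rightarrow> complex" where
  "zeta_sh \<mu> = the_map (\<lambda>f.
     f \<in> QX0 \<mu> \<rightarrow>\<^sub>E Zmu \<mu> \<and>
     linear_over (Qmu \<mu>) scale (*) (QX0 \<mu>) f \<and>
     f (word []) = 1 \<and>
     (\<forall>w. admissible w \<longrightarrow> f (yx w) = zeta \<mu> w) \<and>
     (\<forall>p m m'. special p m m' \<longrightarrow>
        f (yx (p @ [(1, m)]) - yx (p @ [(1, m')])) = zeta_diff \<mu> p m m'))"

definition zeta_sh_T :: "complex \<Rightarrow> rat \<Rightarrow> xletter ncpoly \<Rightarrow> complex poly" where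
  "zeta_sh_T \<mu> m = the_map (\<lambda>f.
     f \<in> QX1 \<mu> \<rightarrow>\<^sub>E ZmuT \<mu> \<and>
     linear_over (Qmu \<mu>) scale smult (QX1 \<mu>) f \<and>
     (\<forall>w\<in>QX0 \<mu>. f w = [:zeta_sh \<mu> w:]) \<and>
     f (word [Y m]) = [:0, 1:] \<and>
     (\<forall>u\<in>QX1 \<mu>. \<forall>v\<in>QX1 \<mu>. f (shuffle u v) = f u * f v))"

definition phi :: "yletter ncpoly \<Rightarrow> xletter ncpoly" where
  "phi = lin_ext yx"

definition rho :: "complex \<Rightarrow> rat \<Rightarrow> rat \<Rightarrow> complex poly \<Rightarrow> complex poly" where
  "rho \<mu> a b = the_map (\<lambda>f.
     Vector_Spaces.linear smult smult f \<and>
     (\<forall>w\<in>QY \<mu>. zeta_sh_T \<mu> b (phi w) = f (zeta_star_T \<mu> a w)))"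

definition H :: "complex \<Rightarrow> complex" where
  "H x = integral {0..1} (\<lambda>t::real. (1 - of_real t powr x) / (1 - of_real t))"

definition c_const :: "complex \<Rightarrow> rat \<Rightarrow> rat \<Rightarrow> complex" where
  "c_const \<mu> a b = H (of_rat b / \<mu> - 1) - H (of_rat a / \<mu> - 1)"

definition varrho_star :: "complex \<Rightarrow> rat \<Rightarrow> rat \<Rightarrow> complex poly \<Rightarrow> complex poly" where
  "varrho_star \<mu> a b p = (\<Sum>s\<le>degree p. smult (coeff p s) ([:c_const \<mu> a b, 1:] ^ s))"

definition varrho_sh :: "complex \<Rightarrow> rat \<Rightarrow> rat \<Rightarrow> complex poly \<Rightarrow> complex poly" where
  "varrho_sh = varrho_star"

end

theory Submission
  imports Defs
begin

text \<open>
  Composing a regularization normalized by \<open>y\<^bsub>1,a\<^esub> \<mapsto> T\<close> with the substitution \<open>T \<mapsto> T + c\<^bsub>a,b\<^esub>\<close> gives one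
  normalized by \<open>y\<^bsub>1,b\<^esub> \<mapsto> T\<close>, because both \<open>\<zeta>\<close>-maps send \<open>y\<^bsub>1,a\<^esub> - y\<^bsub>1,b\<^esub>\<close> to
  \<open>\<Sum>\<^sub>n \<mu>/(n\<mu>+a) - \<mu>/(n\<mu>+b) = c\<^bsub>a,b\<^esub>\<close>; the last equality is the integral of the geometric expansion of
  the integrand of \<open>H\<close>. Hence \<open>\<rho>\<^bsub>m1',m2'\<^esub>\<close> is the conjugate of \<open>\<rho>\<^bsub>m1,m2\<^esub>\<close> by the two substitutions.

  The substitution is a bijection between the maps satisfying the two specifications, so each ``unique
  map'' exists for one base point if and only if it exists for the other; if one of them does not
  exist, every \<open>rho\<close> is the zero map. For coefficients to stay in \<open>Zmu\<close> one needs \<open>Zmu\<close> to be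
  stable under multiplication by \<open>c\<^bsub>a,b\<^esub>\<close>, which follows from multiplicativity of a shuffle
  regularization.
\<close>

section \<open>The constant as a series\<close>

text \<open>The antiderivative t^(x+1)/(x+1) is continuous up to 0 because Re(x+1) > 0, so
  differentiating it on the open interval is enough.\<close>

lemma has_integral_powr_complex_0_1:
  assumes "Re x > -1"
  shows "((\<lambda>t::real. complex_of_real t powr x) has_integral 1 / (x + 1)) {0..1}"
proof -
  let ?f = "\<lambda>t::real. complex_of_real t powr (x + 1) / (x + 1)"
  have nz: "x + 1 \<noteq> 0"
    using assms by (auto simp: complex_eq_iff)
  have "((\<lambda>t::real. complex_of_real t powr x) has_integral (?f 1 - ?f 0)) {0..1}"
  proof (rule fundamental_theorem_of_calculus_interior)
    show "continuous_on {0..1} ?f"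
      using assms nz by (intro continuous_intros) auto
    show "(?f has_vector_derivative complex_of_real t powr x) (at t)" if "t \<in> {0<..<1}" for t
      using that nz
      by (auto intro!: derivative_eq_intros has_vector_derivative_real_field)
  qed auto
  then show ?thesis
    by simp
qed

lemma norm_powr_complex_of_real:
  assumes "t \<ge> 0"
  shows "norm (complex_of_real t powr x) = t powr Re x"
  using assms by (cases "t = 0") (auto simp: norm_powr_real_powr)

text \<open>Mean value inequality on the segment from t to 1, where |s^(x-1)| \<le> s^(-2) \<le> 4.
  The factor 1 - t will cancel the denominator of the integrand of \<open>H\<close> near 1.\<close>

lemma norm_one_minus_powr_le:
  assumes x: "Re x > -1" and t: "1 / 2 \<le> t" "t \<le> 1"
  shows "norm (1 - complex_of_real t powr x) \<le> 4 * norm x * (1 - t)"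
proof -
  let ?S = "closed_segment (complex_of_real t) 1"
  have S: "\<exists>s. z = complex_of_real s \<and> t \<le> s \<and> s \<le> 1" if "z \<in> ?S" for z
    using that closed_segment_of_real[of t 1, where 'a = complex] t
    by (auto simp: closed_segment_eq_real_ivl)
  have "norm (1 powr x - complex_of_real t powr x) \<le> 4 * norm x * norm (1 - complex_of_real t)"
  proof (rule field_differentiable_bound[where S = ?S and f' = "\<lambda>z. x * z powr (x - 1)"])
    fix z assume "z \<in> ?S"
    then obtain s where s: "z = complex_of_real s" "t \<le> s" "s \<le> 1"
      using S by blast
    show "((\<lambda>z. z powr x) has_field_derivative x * z powr (x - 1)) (at z within ?S)"
      using s t by (intro has_field_derivative_at_within[OF has_field_derivative_powr]) auto
    have "s powr (Re x - 1) \<le> s powr (-2)"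
      using s t x by (intro powr_mono') auto
    also have "\<dots> \<le> (1 / 2) powr (-2)"
      using s t by (intro powr_mono2') auto
    also have "(1 / 2 :: real) powr (-2) = 4"
      by (simp add: powr_minus powr_divide)
    finally have "norm (z powr (x - 1)) \<le> 4"
      using s t by (simp add: norm_powr_complex_of_real)
    then show "norm (x * z powr (x - 1)) \<le> 4 * norm x"
      by (metis mult.commute mult_right_mono norm_ge_zero norm_mult)
  qed auto
  also have "norm (1 - complex_of_real t) = 1 - t"
    using t by (metis abs_of_nonneg diff_ge_0_iff_ge norm_of_real of_real_1 of_real_diff)
  finally show ?thesis
    by simp
qed

text \<open>Provides the dominating function for the passage to the limit under the integral. For t
  \<ge> 1/2 the mean value bound cancels the denominator; for t < 1/2 the denominator is at least
  1/2.\<close>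

lemma norm_H_integrand_le:
  assumes x: "Re x > -1" and t: "0 \<le> t" "t \<le> 1"
  shows "norm ((1 - complex_of_real t powr x) / (1 - complex_of_real t))
           \<le> 4 * norm x + 2 + 2 * t powr Re x"
proof (cases "t = 1")
  case False
  have n1: "norm (1 - complex_of_real t) = 1 - t"
    using t by (metis abs_of_nonneg diff_ge_0_iff_ge norm_of_real of_real_1 of_real_diff)
  have pos: "1 - t > 0"
    using t False by simp
  have "norm (1 - complex_of_real t powr x) \<le> (4 * norm x + 2 + 2 * t powr Re x) * (1 - t)"
  proof (cases "1 / 2 \<le> t")
    case True
    have "norm (1 - complex_of_real t powr x) \<le> 4 * norm x * (1 - t)"
      using norm_one_minus_powr_le[OF x True t(2)] .
    also have "\<dots> \<le> (4 * norm x + 2 + 2 * t powr Re x) * (1 - t)"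
      using pos by (intro mult_right_mono) auto
    finally show ?thesis .
  next
    case False
    have "norm (1 - complex_of_real t powr x) \<le> 1 + t powr Re x"
      using norm_triangle_ineq4[of 1 "complex_of_real t powr x"] t
      by (simp add: norm_powr_complex_of_real)
    also have "\<dots> = (2 + 2 * t powr Re x) * (1 / 2)"
      by simp
    also have "\<dots> \<le> (4 * norm x + 2 + 2 * t powr Re x) * (1 - t)"
      using False by (intro mult_mono) auto
    finally show ?thesis .
  qed
  then show ?thesis
    using pos by (simp add: norm_divide n1 divide_le_eq)
qed auto

text \<open>Summing t^n (1 - t^x) over n < N gives (1 - t^N) times the integrand of
  \<open>H\<close>. Termwise integration yields the partial sums, and dominated convergence yields
  the limit.\<close>

lemma H_partial_sums:
  assumes x: "Re x > -1"
  shows "(\<lambda>N. \<Sum>n<N. 1 / (of_nat n + 1) - 1 / (of_nat n + x + 1)) \<longlonglongrightarrow> H x"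
proof -
  define g where "g t = (1 - complex_of_real t powr x) / (1 - complex_of_real t)" for t
  define f where "f N t = (\<Sum>n<N. complex_of_real (t ^ n) - complex_of_real t powr (of_nat n + x))"
    for N :: nat and t
  define h where "h t = 4 * norm x + 2 + 2 * t powr Re x" for t
  have f_eq: "f N t = (1 - complex_of_real t ^ N) * g t" if t: "t \<in> {0..1}" for N t
  proof (cases "t = 0")
    \<comment> \<open>At t = 0 and n = 0 the value of \<open>powr\<close> is 0 whereas the ordinary
      power is 1, so the factorization is checked directly here.\<close>
    case True
    then show ?thesis
      by (cases N) (simp_all add: f_def g_def sum.lessThan_Suc_shift del: sum.lessThan_Suc)
  next
    case False
    have "complex_of_real t powr (of_nat n + x) = complex_of_real t ^ n * complex_of_real t powr x"
      for n
      using False t by (simp add: powr_add powr_nat')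
    then have "f N t = (\<Sum>n<N. complex_of_real t ^ n) * (1 - complex_of_real t powr x)"
      by (simp add: f_def sum_distrib_right right_diff_distrib sum_subtractf)
    then show ?thesis
      by (cases "t = 1") (simp_all add: g_def sum_gp_strict)
  qed
  have int: "((\<lambda>t. complex_of_real (t ^ n) - complex_of_real t powr (of_nat n + x)) has_integral
               1 / (of_nat n + 1) - 1 / (of_nat n + x + 1)) {0..1}" for n :: nat
  proof (intro has_integral_diff)
    have "((\<lambda>t::real. t ^ n) has_integral (1 ^ Suc n / real (Suc n) - 0 ^ Suc n / real (Suc n))) {0..1}"
      by (rule fundamental_theorem_of_calculus)
         (auto intro!: derivative_eq_intros
               simp: has_real_derivative_iff_has_vector_derivative[symmetric]
               simp del: power_Suc of_nat_Suc)
    then have "((\<lambda>t::real. complex_of_real (t ^ n)) has_integral complex_of_real (1 / real (Suc n))) {0..1}"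
      by (intro has_integral_of_real) simp
    then show "((\<lambda>t::real. complex_of_real (t ^ n)) has_integral 1 / (of_nat n + 1)) {0..1}"
      by (simp add: add.commute)
    show "((\<lambda>t. complex_of_real t powr (of_nat n + x)) has_integral 1 / (of_nat n + x + 1)) {0..1}"
      using x by (intro has_integral_powr_complex_0_1) simp
  qed
  have int_f: "(f N has_integral (\<Sum>n<N. 1 / (of_nat n + 1) - 1 / (of_nat n + x + 1))) {0..1}" for N
    unfolding f_def by (intro has_integral_sum int) auto
  have "(\<lambda>N. integral {0..1} (f N)) \<longlonglongrightarrow> integral {0..1} g"
  proof (rule dominated_convergence(2))
    show "f N integrable_on {0..1}" for N
      using int_f by blast
    show "h integrable_on {0..1}"
      unfolding h_def
      by (intro integrable_add integrable_on_mult_right integrable_on_powr_from_0 x)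
         (auto intro: integrable_const_ivl)
    show "norm (f N t) \<le> h t" if t: "t \<in> {0..1}" for N t
    proof -
      have "norm (1 - complex_of_real t ^ N) \<le> 1"
      proof -
        have "1 - complex_of_real t ^ N = complex_of_real (1 - t ^ N)"
          by simp
        moreover have "0 \<le> t ^ N" "t ^ N \<le> 1"
          using t by (auto intro: power_le_one)
        ultimately show ?thesis
          by (simp only: norm_of_real)
      qed
      then have "norm (f N t) \<le> norm (g t)"
        by (simp add: f_eq[OF t] norm_mult mult_left_le_one_le)
      also have "\<dots> \<le> h t"
        using norm_H_integrand_le[OF x] t by (auto simp: g_def h_def)
      finally show ?thesis .
    qed
    show "(\<lambda>N. f N t) \<longlonglongrightarrow> g t" if t: "t \<in> {0..1}" for t
    proof (cases "t = 1")
      \<comment> \<open>Division by zero gives \<open>g 1 = 0\<close>, and every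
        \<open>f N 1\<close> vanishes as well.\<close>
      case True
      then show ?thesis
        by (simp add: f_def g_def)
    next
      case False
      then have "(\<lambda>N. complex_of_real t ^ N) \<longlonglongrightarrow> 0"
        using t by (intro LIMSEQ_power_zero) auto
      then have "(\<lambda>N. (1 - complex_of_real t ^ N) * g t) \<longlonglongrightarrow> (1 - 0) * g t"
        by (intro tendsto_mult tendsto_diff tendsto_const)
      then show ?thesis
        by (simp add: f_eq[OF t])
    qed
  qed
  moreover have "integral {0..1} (f N) = (\<Sum>n<N. 1 / (of_nat n + 1) - 1 / (of_nat n + x + 1))" for N
    using int_f by (rule integral_unique)
  moreover have "integral {0..1} g = H x"
    by (simp add: H_def g_def[abs_def])
  ultimately show ?thesis
    by simp
qed

lemma Re_of_rat [simp]: "Re (of_rat r) = of_rat r"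
  and Im_of_rat [simp]: "Im (of_rat r) = 0"
proof -
  have "complex_of_rat r = complex_of_real (real_of_rat r)"
    by (cases r) (simp add: of_rat_rat)
  then show "Re (of_rat r) = of_rat r" "Im (of_rat r) = 0"
    by (simp_all only: Re_complex_of_real Im_complex_of_real)
qed

lemma Re_of_rat_divide_pos:
  assumes "Re \<mu> > 0" "a > 0"
  shows "Re (of_rat a / \<mu>) > 0"
  using assms by (auto simp: Re_divide intro!: divide_pos_pos add_pos_nonneg)

text \<open>For x = r/\<mu> - 1 the term 1/(n + x + 1) equals \<mu>/(n\<mu> + r); the harmonic terms
  1/(n + 1) cancel in the difference of the two \<open>H\<close> values.\<close>

lemma c_const_sums:
  assumes \<mu>: "Re \<mu> > 0" and a: "a > 0" and b: "b > 0"
  shows "(\<lambda>n. \<mu> / (of_nat n * \<mu> + of_rat a) - \<mu> / (of_nat n * \<mu> + of_rat b)) sums c_const \<mu> a b"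
proof -
  have [simp]: "\<mu> \<noteq> 0"
    using \<mu> by auto
  have *: "1 / (of_nat n + (of_rat r / \<mu> - 1) + 1) = \<mu> / (of_nat n * \<mu> + of_rat r)" for n :: nat and r
    by (simp add: add_divide_eq_iff divide_divide_eq_right)
  have Ha: "(\<lambda>N. \<Sum>n<N. 1 / (of_nat n + 1) - \<mu> / (of_nat n * \<mu> + of_rat a)) \<longlonglongrightarrow> H (of_rat a / \<mu> - 1)"
    using H_partial_sums[of "of_rat a / \<mu> - 1"] Re_of_rat_divide_pos[OF \<mu> a] by (simp only: *) simp
  have Hb: "(\<lambda>N. \<Sum>n<N. 1 / (of_nat n + 1) - \<mu> / (of_nat n * \<mu> + of_rat b)) \<longlonglongrightarrow> H (of_rat b / \<mu> - 1)"
    using H_partial_sums[of "of_rat b / \<mu> - 1"] Re_of_rat_divide_pos[OF \<mu> b] by (simp only: *) simp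
  show ?thesis
    using tendsto_diff[OF Hb Ha] by (simp add: sums_def c_const_def flip: sum_subtractf)
qed

section \<open>Both zeta maps on a difference of two letters of weight one\<close>

lemma chains_1: "chains (Suc 0) = range (\<lambda>n. [n])"
  by (auto simp: chains_def length_Suc_conv)

lemma Re_mult_add_of_rat_pos:
  assumes "Re \<mu> > 0" "a > 0"
  shows "Re (of_nat n * \<mu> + of_rat a) > 0"
  using assms by (auto intro!: add_nonneg_pos)

text \<open>Partial fractions turn the summand into the one of \<open>c_const_sums\<close>. The
  unordered sum in \<open>zeta_diff\<close> requires absolute convergence, which holds since |n\<mu>
  + r| \<ge> n Re \<mu> makes the terms O(1/n^2).\<close>

lemma zeta_diff_Nil:
  assumes \<mu>: "Re \<mu> > 0" and a: "a > 0" and b: "b > 0"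
  shows "zeta_diff \<mu> [] a b = c_const \<mu> a b"
proof -
  define f where "f n = \<mu> / ((of_nat n * \<mu> + of_rat a) * (of_nat n * \<mu> + of_rat b))" for n :: nat
  have nz: "of_nat n * \<mu> + of_rat a \<noteq> 0" "of_nat n * \<mu> + of_rat b \<noteq> 0" for n
    using Re_mult_add_of_rat_pos[OF \<mu> a, of n] Re_mult_add_of_rat_pos[OF \<mu> b, of n] by force+
  have f_eq: "of_rat (b - a) * f n = \<mu> / (of_nat n * \<mu> + of_rat a) - \<mu> / (of_nat n * \<mu> + of_rat b)" for n
    using nz[of n] by (simp add: f_def of_rat_diff divide_simps) (simp add: algebra_simps)
  have "summable (\<lambda>n. norm (f n))"
  proof (rule summable_comparison_test_ev)
    show "summable (\<lambda>n. norm \<mu> / (Re \<mu>)\<^sup>2 * (1 / real n ^ 2))"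
      by (intro summable_mult inverse_power_summable[THEN summable_cong[THEN iffD1, rotated]]) (auto simp: field_simps)
    show "\<forall>\<^sub>F n in sequentially. norm (norm (f n)) \<le> norm \<mu> / (Re \<mu>)\<^sup>2 * (1 / real n ^ 2)"
      \<comment> \<open>At n = 0 the majorant is 0 by the convention for division by zero, so the
        comparison is made for n > 0 only.\<close>
      using eventually_gt_at_top[of 0]
    proof eventually_elim
      case (elim n)
      have le: "real n * Re \<mu> \<le> norm (of_nat n * \<mu> + of_rat r)" if "r > 0" for r
        using complex_Re_le_cmod[of "of_nat n * \<mu> + of_rat r"] that
        by (simp add: order_trans[rotated])
      have pos: "real n * Re \<mu> > 0"
        using elim \<mu> by simp
      have "norm (f n) \<le> norm \<mu> / ((real n * Re \<mu>) * (real n * Re \<mu>))"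
        unfolding f_def norm_divide norm_mult
        using le[OF a] le[OF b] pos elim \<mu> nz by (intro divide_left_mono mult_mono mult_pos_pos) auto
      then show ?case
        by (simp add: power2_eq_square field_simps)
    qed
  qed
  moreover have "(\<lambda>n. of_rat (b - a) * f n) sums c_const \<mu> a b"
    using c_const_sums[OF \<mu> a b] by (simp only: f_eq)
  ultimately have "((\<lambda>n. of_rat (b - a) * f n) has_sum c_const \<mu> a b) UNIV"
    by (intro norm_summable_imp_has_sum) (auto simp: norm_mult intro: summable_mult)
  then have "c_const \<mu> a b = (\<Sum>\<^sub>\<infinity>n. of_rat (b - a) * f n)"
    by (simp add: infsumI)
  also have "\<dots> = of_rat (b - a) * (\<Sum>\<^sub>\<infinity>n. f n)"
    by (rule infsum_cmult_right')
  also have "(\<Sum>\<^sub>\<infinity>n. f n) = (\<Sum>\<^sub>\<infinity>ns\<in>chains (Suc 0).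
      \<mu> / ((of_nat (ns ! 0) * \<mu> + of_rat a) * (of_nat (ns ! 0) * \<mu> + of_rat b)))"
    unfolding chains_1 by (subst infsum_reindex) (auto simp: inj_on_def o_def f_def[abs_def])
  finally show ?thesis
    by (simp add: zeta_diff_def)
qed

text \<open>Each truncated value of the difference is a partial sum of the series in
  \<open>c_const_sums\<close>.\<close>

lemma zeta_star_y1_diff:
  assumes \<mu>: "Re \<mu> > 0" and a: "a > 0" and b: "b > 0"
  shows "zeta_star \<mu> (word [(1, a)] - word [(1, b)]) = c_const \<mu> a b"
proof (cases "a = b")
  case True
  then show ?thesis
    by (simp add: zeta_star_def zeta_trunc_def c_const_def)
next
  case ab: False
  let ?p = "word [(1, a)] - word [(1, b)] :: yletter ncpoly"
  let ?t = "\<lambda>M w. \<Sum>ns\<in>{ns\<in>chains (length w). set ns \<subseteq> {..M}}. zeta_term \<mu> w ns"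
  have t: "?t M [(1, r)] = (\<Sum>n<Suc M. \<mu> / (of_nat n * \<mu> + of_rat r))" for M r
  proof -
    have "{ns\<in>chains (length [(1::nat, r)]). set ns \<subseteq> {..M}} = (\<lambda>n. [n]) ` {..<Suc M}"
      by (auto simp: chains_1)
    then show ?thesis
      by (simp only:) (subst sum.reindex, auto simp: inj_on_def zeta_term_def)
  qed
  have "zeta_trunc \<mu> M ?p = (\<Sum>n<Suc M. \<mu> / (of_nat n * \<mu> + of_rat a) - \<mu> / (of_nat n * \<mu> + of_rat b))" for M
  proof -
    have "zeta_trunc \<mu> M ?p = (\<Sum>w\<in>{[(1, a)], [(1, b)]}. Poly_Mapping.lookup ?p w * ?t M w)"
      unfolding zeta_trunc_def
      by (rule sum.mono_neutral_left)
         (auto simp: word_def lookup_minus lookup_single in_keys_iff when_def split: if_splits)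
    also have "\<dots> = ?t M [(1, a)] - ?t M [(1, b)]"
      using ab by (simp add: word_def lookup_minus lookup_single when_def)
    finally show ?thesis
      by (simp only: t sum_subtractf)
  qed
  then have "(\<lambda>M. zeta_trunc \<mu> M ?p) \<longlonglongrightarrow> c_const \<mu> a b"
    \<comment> \<open>Truncation at M includes n = M, hence M + 1 terms and a shifted
      sequence.\<close>
    using LIMSEQ_Suc[OF c_const_sums[OF \<mu> a b, unfolded sums_def]] by simp
  then show ?thesis
    unfolding zeta_star_def by (rule limI)
qed

section \<open>Spans of words over \<open>\<rat>[\<mu>]\<close>\<close>

lemma map_poly_of_rat_add:
  "map_poly of_rat (p + q) = map_poly of_rat p + (map_poly of_rat q :: complex poly)"
  by (rule poly_eqI) (simp add: coeff_map_poly of_rat_add)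

lemma map_poly_of_rat_mult:
  "map_poly of_rat (p * q) = map_poly of_rat p * (map_poly of_rat q :: complex poly)"
  by (rule poly_eqI) (simp add: coeff_map_poly coeff_mult of_rat_sum of_rat_mult)

lemma Qmu_0: "0 \<in> Qmu \<mu>"
  unfolding Qmu_def by (rule range_eqI[of _ _ 0]) simp

lemma Qmu_1: "1 \<in> Qmu \<mu>"
  unfolding Qmu_def by (rule range_eqI[of _ _ 1]) simp

lemma Qmu_mu: "\<mu> \<in> Qmu \<mu>"
  unfolding Qmu_def by (rule range_eqI[of _ _ "[:0, 1:]"]) (simp add: map_poly_pCons)

lemma Qmu_of_rat: "of_rat r \<in> Qmu \<mu>"
  unfolding Qmu_def by (rule range_eqI[of _ _ "[:r:]"]) (simp add: map_poly_pCons)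

lemma Qmu_add: "x \<in> Qmu \<mu> \<Longrightarrow> y \<in> Qmu \<mu> \<Longrightarrow> x + y \<in> Qmu \<mu>"
  unfolding Qmu_def
proof clarify
  fix p q :: "rat poly"
  show "poly (map_poly of_rat p) \<mu> + poly (map_poly of_rat q) \<mu>
          \<in> range (\<lambda>p. poly (map_poly of_rat p) \<mu>)"
    by (rule range_eqI[of _ _ "p + q"]) (simp add: map_poly_of_rat_add)
qed

lemma Qmu_mult: "x \<in> Qmu \<mu> \<Longrightarrow> y \<in> Qmu \<mu> \<Longrightarrow> x * y \<in> Qmu \<mu>"
  unfolding Qmu_def
proof clarify
  fix p q :: "rat poly"
  show "poly (map_poly of_rat p) \<mu> * poly (map_poly of_rat q) \<mu>
          \<in> range (\<lambda>p. poly (map_poly of_rat p) \<mu>)"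
    by (rule range_eqI[of _ _ "p * q"]) (simp add: map_poly_of_rat_mult)
qed

lemma Qmu_minus: "x \<in> Qmu \<mu> \<Longrightarrow> - x \<in> Qmu \<mu>"
  using Qmu_mult[OF Qmu_of_rat[of "-1"]] by fastforce

lemma Qmu_diff: "x \<in> Qmu \<mu> \<Longrightarrow> y \<in> Qmu \<mu> \<Longrightarrow> x - y \<in> Qmu \<mu>"
  using Qmu_add[OF _ Qmu_minus] by fastforce

section \<open>Linear structure, spans, and polynomials supported on a set of words\<close>

lemma lookup_scale: "Poly_Mapping.lookup (scale c p) w = c * Poly_Mapping.lookup p w"
  by (auto simp: scale_def map.rep_eq when_def)

interpretation scale: module "scale :: complex \<Rightarrow> 'a ncpoly \<Rightarrow> 'a ncpoly"
  by unfold_locales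
     (auto intro!: poly_mapping_eqI simp: lookup_scale lookup_add algebra_simps)

text \<open>The tool for all later inclusions of spans such as \<open>QY0\<close>,
  \<open>QX0\<close> and \<open>Zmu\<close> in larger sets.\<close>

lemma span_over_subset:
  assumes "S \<subseteq> V" "0 \<in> V" "\<And>u v. u \<in> V \<Longrightarrow> v \<in> V \<Longrightarrow> u + v \<in> V"
    and "\<And>c v. c \<in> R \<Longrightarrow> v \<in> V \<Longrightarrow> sc c v \<in> V"
  shows "span_over R sc S \<subseteq> V"
proof -
  have "(\<Sum>v\<in>F. sc (c v) v) \<in> V" if "finite F" "F \<subseteq> S" "c ` F \<subseteq> R" for F c
    using that by induction (use assms in auto)
  then show ?thesis
    by (auto simp: span_over_def)
qed

lemma span_over_add:
  fixes sc :: "complex \<Rightarrow> 'v::ab_group_add \<Rightarrow> 'v"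
  assumes "module sc" and R: "0 \<in> R" "\<And>x y. x \<in> R \<Longrightarrow> y \<in> R \<Longrightarrow> x + y \<in> R"
    and "u \<in> span_over R sc S" "v \<in> span_over R sc S"
  shows "u + v \<in> span_over R sc S"
proof -
  interpret module sc by fact
  obtain F c where F: "finite F" "F \<subseteq> S" "c ` F \<subseteq> R" "u = (\<Sum>x\<in>F. sc (c x) x)"
    using assms(4) by (auto simp: span_over_def)
  obtain G d where G: "finite G" "G \<subseteq> S" "d ` G \<subseteq> R" "v = (\<Sum>x\<in>G. sc (d x) x)"
    using assms(5) by (auto simp: span_over_def)
  \<comment> \<open>Extending the coefficients by zero lets both combinations run over
    \<open>F \<union> G\<close>, where they can be added termwise.\<close>
  define c' where "c' x = (if x \<in> F then c x else 0)" for x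
  define d' where "d' x = (if x \<in> G then d x else 0)" for x
  have "u = (\<Sum>x\<in>F \<union> G. sc (c' x) x)"
    unfolding F(4) using F(1) G(1) by (intro sum.mono_neutral_cong_left) (auto simp: c'_def)
  moreover have "v = (\<Sum>x\<in>F \<union> G. sc (d' x) x)"
    unfolding G(4) using F(1) G(1) by (intro sum.mono_neutral_cong_left) (auto simp: d'_def)
  ultimately have "u + v = (\<Sum>x\<in>F \<union> G. sc (c' x + d' x) x)"
    by (simp add: sum.distrib scale_left_distrib)
  moreover have "(\<lambda>x. c' x + d' x) ` (F \<union> G) \<subseteq> R"
    using F(3) G(3) R by (auto simp: c'_def d'_def image_subset_iff)
  ultimately show ?thesis
    unfolding span_over_def using F(1,2) G(1,2)
    by (intro CollectI exI[of _ "F \<union> G"] exI[of _ "\<lambda>x. c' x + d' x"]) auto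
qed

lemma span_over_scale:
  fixes sc :: "complex \<Rightarrow> 'v::ab_group_add \<Rightarrow> 'v"
  assumes "module sc" and R: "\<And>x y. x \<in> R \<Longrightarrow> y \<in> R \<Longrightarrow> x * y \<in> R"
    and "r \<in> R" "u \<in> span_over R sc S"
  shows "sc r u \<in> span_over R sc S"
proof -
  interpret module sc by fact
  obtain F c where F: "finite F" "F \<subseteq> S" "c ` F \<subseteq> R" "u = (\<Sum>x\<in>F. sc (c x) x)"
    using assms(4) by (auto simp: span_over_def)
  have "sc r u = (\<Sum>x\<in>F. sc (r * c x) x)"
    by (simp add: F(4) scale_sum_right)
  then show ?thesis
    unfolding span_over_def using F(1-3) R \<open>r \<in> R\<close>
    by (intro CollectI exI[of _ F] exI[of _ "\<lambda>x. r * c x"]) auto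
qed

lemma span_over_0: "0 \<in> span_over R sc S"
  unfolding span_over_def by (intro CollectI exI[of _ "{}"]) auto

lemma span_over_base:
  fixes sc :: "complex \<Rightarrow> 'v::ab_group_add \<Rightarrow> 'v"
  assumes "module sc" and "1 \<in> R" "v \<in> S"
  shows "v \<in> span_over R sc S"
proof -
  interpret module sc by fact
  show ?thesis
    unfolding span_over_def using assms
    by (intro CollectI exI[of _ "{v}"] exI[of _ "\<lambda>_. 1"]) auto
qed

text \<open>The span of the words in \<open>W\<close> described by coefficients and support, so that
  closure properties reduce to inspecting words. \<open>QY\<close> and \<open>QX1\<close> both turn
  out to be of this form.\<close>

definition ncpolys_over :: "complex \<Rightarrow> 'a list set \<Rightarrow> 'a ncpoly set" where
  "ncpolys_over \<mu> W =
     {p. (\<forall>w. Poly_Mapping.lookup p w \<in> Qmu \<mu>) \<and> Poly_Mapping.keys p \<subseteq> W}"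

lemma ncpolys_over_0: "0 \<in> ncpolys_over \<mu> W"
  by (simp add: ncpolys_over_def Qmu_0)

lemma ncpolys_over_add:
  "p \<in> ncpolys_over \<mu> W \<Longrightarrow> q \<in> ncpolys_over \<mu> W \<Longrightarrow> p + q \<in> ncpolys_over \<mu> W"
  using keys_add[of p q] by (auto simp: ncpolys_over_def lookup_add intro: Qmu_add)

lemma ncpolys_over_scale:
  "c \<in> Qmu \<mu> \<Longrightarrow> p \<in> ncpolys_over \<mu> W \<Longrightarrow> scale c p \<in> ncpolys_over \<mu> W"
  by (auto simp: ncpolys_over_def lookup_scale in_keys_iff subset_iff intro: Qmu_mult)

lemma ncpolys_over_diff:
  "p \<in> ncpolys_over \<mu> W \<Longrightarrow> q \<in> ncpolys_over \<mu> W \<Longrightarrow> p - q \<in> ncpolys_over \<mu> W"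
  using keys_diff[of p q] by (auto simp: ncpolys_over_def lookup_minus intro: Qmu_diff)

lemma ncpolys_over_sum:
  "(\<And>i. i \<in> I \<Longrightarrow> f i \<in> ncpolys_over \<mu> W) \<Longrightarrow> (\<Sum>i\<in>I. f i) \<in> ncpolys_over \<mu> W"
  by (induction I rule: infinite_finite_induct) (auto intro: ncpolys_over_0 ncpolys_over_add)

lemma ncpolys_over_word: "w \<in> W \<Longrightarrow> word w \<in> ncpolys_over \<mu> W"
  by (auto simp: ncpolys_over_def word_def lookup_single when_def Qmu_0 Qmu_1)

lemma ncpolys_over_lin_ext:
  assumes "p \<in> ncpolys_over \<mu> V" "\<And>v. v \<in> V \<Longrightarrow> f v \<in> ncpolys_over \<mu> W"
  shows "lin_ext f p \<in> ncpolys_over \<mu> W"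
  using assms unfolding lin_ext_def
  by (intro ncpolys_over_sum ncpolys_over_scale) (auto simp: ncpolys_over_def)

lemma ncpolys_over_bilin_ext:
  assumes "p \<in> ncpolys_over \<mu> U" "q \<in> ncpolys_over \<mu> V"
    and "\<And>u v. u \<in> U \<Longrightarrow> v \<in> V \<Longrightarrow> f u v \<in> ncpolys_over \<mu> W"
  shows "bilin_ext f p q \<in> ncpolys_over \<mu> W"
  unfolding bilin_ext_def
  by (intro ncpolys_over_lin_ext[OF assms(1)] ncpolys_over_lin_ext[OF assms(2)] assms(3))

lemma ncpolys_over_concat_prod:
  assumes "p \<in> ncpolys_over \<mu> U" "q \<in> ncpolys_over \<mu> V"
    and "\<And>u v. u \<in> U \<Longrightarrow> v \<in> V \<Longrightarrow> u @ v \<in> W"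
  shows "concat_prod p q \<in> ncpolys_over \<mu> W"
  unfolding concat_prod_def
  by (intro ncpolys_over_bilin_ext[OF assms(1,2)] ncpolys_over_word assms(3))

lemma span_over_word: "span_over (Qmu \<mu>) scale (word ` W) = ncpolys_over \<mu> W"
proof
  show "span_over (Qmu \<mu>) scale (word ` W) \<subseteq> ncpolys_over \<mu> W"
    by (intro span_over_subset)
       (auto intro: ncpolys_over_word ncpolys_over_0 ncpolys_over_add ncpolys_over_scale)
  show "ncpolys_over \<mu> W \<subseteq> span_over (Qmu \<mu>) scale (word ` W)"
  proof
    fix p assume p: "p \<in> ncpolys_over \<mu> W"
    have "p = (\<Sum>w\<in>Poly_Mapping.keys p. scale (Poly_Mapping.lookup p w) (word w))"
      by (rule poly_mapping_eqI)
         (auto simp: lookup_sum lookup_scale word_def lookup_single when_def in_keys_iff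
            if_distrib[of "(*) _"] cong: if_cong)
    moreover have "(\<Sum>w\<in>V. scale (Poly_Mapping.lookup p w) (word w))
        \<in> span_over (Qmu \<mu>) scale (word ` W)" if "finite V" "V \<subseteq> W" for V
      using that
    proof induction
      case (insert w V)
      have "scale (Poly_Mapping.lookup p w) (word w) \<in> span_over (Qmu \<mu>) scale (word ` W)"
        using insert.prems p
        by (intro span_over_scale span_over_base scale.module_axioms Qmu_mult Qmu_1)
           (auto simp: ncpolys_over_def)
      then show ?case
        using insert by (auto intro!: span_over_add scale.module_axioms Qmu_0 Qmu_add)
    qed (simp add: span_over_0)
    ultimately show "p \<in> span_over (Qmu \<mu>) scale (word ` W)"
      using p by (metis (no_types, lifting) finite_keys mem_Collect_eq ncpolys_over_def)
  qed
qed

lemma lin_ext_word: "lin_ext f (word w) = f w"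
  by (simp add: lin_ext_def word_def)

lemma bilin_ext_word: "bilin_ext f (word u) (word v) = f u v"
  by (simp add: bilin_ext_def lin_ext_word)

section \<open>The two word spaces and their stability under the products\<close>

lemma QY_eq: "QY \<mu> = ncpolys_over \<mu> (Collect positive)"
  by (auto simp: QY_def ncpolys_over_def)

lemma positive_append: "positive (u @ v) \<longleftrightarrow> positive u \<and> positive v"
  by (auto simp: positive_def)

text \<open>The coefficients supplied by \<open>partial_fraction\<close> are rational by their type,
  and every letter that occurs has exponent at least 1 and an index taken from x or y.\<close>

lemma odot_in_QY:
  assumes "positive [x]" "positive [y]"
  shows "odot x y \<in> QY \<mu>"
  using assms unfolding QY_eq
  by (cases x; cases y)
     (auto simp: odot_def positive_def split: prod.splits
        intro!: ncpolys_over_add ncpolys_over_sum ncpolys_over_scale ncpolys_over_word Qmu_of_rat)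

lemma stuffle_rev_in_QY:
  "positive u \<Longrightarrow> positive v \<Longrightarrow> stuffle_rev \<mu> u v \<in> QY \<mu>"
proof (induction \<mu> u v rule: stuffle_rev.induct)
  case (3 \<mu> x u y v)
  have "positive [x]" "positive [y]" "positive u" "positive v"
    using 3 by (auto simp: positive_def)
  with 3 odot_in_QY[of x y \<mu>] show ?case
    unfolding stuffle_rev.simps QY_eq
    by (intro ncpolys_over_add ncpolys_over_diff ncpolys_over_scale Qmu_mu
          ncpolys_over_concat_prod[where U = "Collect positive" and V = "Collect positive"]
          ncpolys_over_word)
       (auto simp: positive_append)
qed (auto simp: QY_eq positive_def intro!: ncpolys_over_word)

lemma stuffle_in_QY: "u \<in> QY \<mu> \<Longrightarrow> v \<in> QY \<mu> \<Longrightarrow> stuffle \<mu> u v \<in> QY \<mu>"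
  unfolding stuffle_def QY_eq
  by (erule (1) ncpolys_over_bilin_ext)
     (auto simp flip: QY_eq simp: positive_def intro!: stuffle_rev_in_QY)

lemma QY0_subset_QY: "QY0 \<mu> \<subseteq> QY \<mu>"
  unfolding QY0_def QY_eq
  by (intro span_over_subset)
     (auto intro!: ncpolys_over_word ncpolys_over_diff
        intro: ncpolys_over_0 ncpolys_over_add ncpolys_over_scale
        simp: admissible_def special_def positive_append, auto simp: positive_def)

text \<open>\<open>prefix_sums_pos 0\<close> describes the words \<open>(y,x)\<^bsub>k;m\<^esub>\<close> of positive bi-indices: every nonempty
  prefix has positive sum of indices (which forces the first letter to be a \<open>Y\<close>). This condition is
  visibly stable under shuffling.\<close>

fun prefix_sums_pos :: "rat \<Rightarrow> xletter list \<Rightarrow> bool" where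
  "prefix_sums_pos s [] \<longleftrightarrow> True"
| "prefix_sums_pos s (X # w) \<longleftrightarrow> s > 0 \<and> prefix_sums_pos s w"
| "prefix_sums_pos s (Y r # w) \<longleftrightarrow> s + r > 0 \<and> prefix_sums_pos (s + r) w"

fun y_sum :: "xletter list \<Rightarrow> rat" where
  "y_sum [] = 0"
| "y_sum (X # w) = y_sum w"
| "y_sum (Y r # w) = r + y_sum w"

lemma y_sum_append: "y_sum (u @ v) = y_sum u + y_sum v"
  by (induction u rule: y_sum.induct) auto

lemma y_sum_rev: "y_sum (rev u) = y_sum u"
  by (induction u rule: y_sum.induct) (auto simp: y_sum_append)

lemma prefix_sums_pos_append: "prefix_sums_pos s (u @ v) \<longleftrightarrow> prefix_sums_pos s u \<and> prefix_sums_pos (s + y_sum u) v"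
  by (induction s u rule: prefix_sums_pos.induct) (auto simp: add.assoc)

lemma prefix_sums_pos_single: "prefix_sums_pos s [x] \<longleftrightarrow> s + y_sum [x] > 0"
  by (cases x) auto

lemma prefix_sums_pos_replicate_X: "s > 0 \<Longrightarrow> prefix_sums_pos s (replicate n X @ w) \<longleftrightarrow> prefix_sums_pos s w"
  by (induction n) auto

lemma prefix_sums_pos_yx_from: "positive w \<Longrightarrow> prefix_sums_pos m (yx_from m w)"
  by (induction m w rule: yx_from.induct) (auto simp: positive_def prefix_sums_pos_replicate_X)

text \<open>Here m is the running sum, that is, the index of the preceding letter. Stripping the
  first letter can leave symbols \<open>X\<close> that belong to a letter already removed;
  \<open>j\<close> counts them. For m \<le> 0 no \<open>X\<close> can come first, so at m = 0 the
  whole word arises from a bi-index.\<close>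

lemma prefix_sums_pos_imp_yx_from:
  "prefix_sums_pos m v \<Longrightarrow> \<exists>j w. positive w \<and> v = replicate j X @ yx_from m w \<and> (m \<le> 0 \<longrightarrow> j = 0)"
proof (induction m v rule: prefix_sums_pos.induct)
  case (1 s)
  show ?case
    by (rule exI[of _ 0], rule exI[of _ "[]"]) (simp add: positive_def)
next
  case (2 s v)
  then obtain j w where "positive w" "v = replicate j X @ yx_from s w"
    by auto
  then show ?case
    using 2 by (intro exI[of _ "Suc j"] exI[of _ w]) auto
next
  case (3 s r v)
  then obtain j w where "positive w" "v = replicate j X @ yx_from (s + r) w"
    by auto
  then show ?case
    \<comment> \<open>The \<open>j\<close> leading symbols \<open>X\<close> of the tail are absorbed
      into the exponent of the new letter, which has index s + r.\<close>
    using 3 by (intro exI[of _ 0] exI[of _ "(Suc j, s + r) # w"]) (auto simp: positive_def)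
qed

lemma yx_words_eq: "{yx w | w. positive w} = word ` Collect (prefix_sums_pos 0)"
proof (intro equalityI subsetI)
  fix p assume "p \<in> word ` Collect (prefix_sums_pos 0)"
  then obtain v where "p = word v" "prefix_sums_pos 0 v"
    by auto
  then show "p \<in> {yx w | w. positive w}"
    using prefix_sums_pos_imp_yx_from[of 0 v] by (auto simp: yx_def)
qed (auto simp: yx_def prefix_sums_pos_yx_from)

lemma QX1_eq: "QX1 \<mu> = ncpolys_over \<mu> (Collect (prefix_sums_pos 0))"
  unfolding QX1_def yx_words_eq by (rule span_over_word)

lemma yx_in_QX1: "positive w \<Longrightarrow> yx w \<in> QX1 \<mu>"
  by (auto simp: QX1_eq yx_def prefix_sums_pos_yx_from intro!: ncpolys_over_word)

lemma phi_in_QX1: "w \<in> QY \<mu> \<Longrightarrow> phi w \<in> QX1 \<mu>"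
  unfolding QY_eq QX1_eq phi_def
  by (erule ncpolys_over_lin_ext) (use yx_in_QX1 QX1_eq in auto)

lemma QX0_subset_QX1: "QX0 \<mu> \<subseteq> QX1 \<mu>"
  unfolding QX0_def QX1_eq
proof (intro span_over_subset)
  have "positive []" "positive w" if "admissible w" for w
    using that by (auto simp: positive_def admissible_def)
  moreover have "positive (p @ [(1, m)])" "positive (p @ [(1, m')])" if "special p m m'" for p m m'
    using that by (auto simp: special_def positive_def)
  ultimately show "{word []} \<union> {yx w | w. admissible w} \<union>
      {yx (p @ [(1, m)]) - yx (p @ [(1, m')]) | p m m'. special p m m'}
      \<subseteq> ncpolys_over \<mu> (Collect (prefix_sums_pos 0))"
    unfolding QX1_eq[symmetric]
    by (auto intro!: yx_in_QX1 ncpolys_over_diff[of _ _ "Collect (prefix_sums_pos 0)", folded QX1_eq])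
       (simp add: QX1_eq ncpolys_over_word)
qed (auto intro: ncpolys_over_0 ncpolys_over_add ncpolys_over_scale)

text \<open>Appending a last letter creates one new prefix, the whole word, whose sum is the sum of
  the two positive totals. Carrying \<open>y_sum\<close> through the induction makes this total
  available.\<close>

lemma shuffle_rev_prefix_sums_pos:
  "prefix_sums_pos 0 (rev u) \<Longrightarrow> prefix_sums_pos 0 (rev v) \<Longrightarrow>
     shuffle_rev u v \<in> ncpolys_over \<mu> {w. prefix_sums_pos 0 w \<and> y_sum w = y_sum u + y_sum v}"
proof (induction u v rule: shuffle_rev.induct)
  case (3 x u y v)
  have x: "prefix_sums_pos 0 (rev u)" "y_sum u + y_sum [x] > 0"
    and y: "prefix_sums_pos 0 (rev v)" "y_sum v + y_sum [y] > 0"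
    using 3(3,4) by (auto simp: prefix_sums_pos_append prefix_sums_pos_single y_sum_rev simp del: y_sum.simps)
  have c: "y_sum (a # w) = y_sum w + y_sum [a]" for a w
    by (cases a) auto
  have "concat_prod (shuffle_rev u (y # v)) (word [x])
      \<in> ncpolys_over \<mu> {w. prefix_sums_pos 0 w \<and> y_sum w = y_sum (x # u) + y_sum (y # v)}"
    using x y 3
    by (intro ncpolys_over_concat_prod[OF 3(1) ncpolys_over_word[OF singletonI]])
       (auto simp: prefix_sums_pos_append prefix_sums_pos_single y_sum_append c[of x u] c[of y v] simp del: y_sum.simps)
  moreover have "concat_prod (shuffle_rev (x # u) v) (word [y])
      \<in> ncpolys_over \<mu> {w. prefix_sums_pos 0 w \<and> y_sum w = y_sum (x # u) + y_sum (y # v)}"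
    using x y 3
    by (intro ncpolys_over_concat_prod[OF 3(2) ncpolys_over_word[OF singletonI]])
       (auto simp: prefix_sums_pos_append prefix_sums_pos_single y_sum_append c[of x u] c[of y v] simp del: y_sum.simps)
  ultimately show ?case
    unfolding shuffle_rev.simps by (rule ncpolys_over_add)
qed (auto intro!: ncpolys_over_word simp: y_sum_rev simp del: rev.simps)

lemma shuffle_in_QX1: "u \<in> QX1 \<mu> \<Longrightarrow> v \<in> QX1 \<mu> \<Longrightarrow> shuffle u v \<in> QX1 \<mu>"
  unfolding shuffle_def QX1_eq
proof (erule (1) ncpolys_over_bilin_ext)
  fix u v assume "u \<in> Collect (prefix_sums_pos 0)" "v \<in> Collect (prefix_sums_pos 0)"
  then have "shuffle_rev (rev u) (rev v)
      \<in> ncpolys_over \<mu> {w. prefix_sums_pos 0 w \<and> y_sum w = y_sum (rev u) + y_sum (rev v)}"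
    by (intro shuffle_rev_prefix_sums_pos) auto
  then show "shuffle_rev (rev u) (rev v) \<in> ncpolys_over \<mu> (Collect (prefix_sums_pos 0))"
    by (auto simp: ncpolys_over_def)
qed

section \<open>Change of base point\<close>

lemma the_map_spec: "\<exists>!f. P f \<Longrightarrow> P (the_map P)"
  by (simp add: the_map_def theI')

lemma the_map_eqI: "\<exists>!f. P f \<Longrightarrow> P f \<Longrightarrow> the_map P = f"
  by (auto simp: the_map_def)

lemma the_map_junk: "\<not> (\<exists>!f. P f) \<Longrightarrow> the_map P = (\<lambda>_. 0)"
  by (simp add: the_map_def)

text \<open>Any g with \<open>Q g\<close> equals \<open>F (G g)\<close>, and \<open>G g\<close> must
  be the unique solution of \<open>P\<close>.\<close>

lemma ex1_transfer:
  assumes "\<exists>!f. P f" "\<And>f. P f \<Longrightarrow> Q (F f)" "\<And>g. Q g \<Longrightarrow> P (G g)" "\<And>g. Q g \<Longrightarrow> F (G g) = g"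
  shows "\<exists>!g. Q g"
  using assms by metis

section \<open>Polynomials over \<open>Zmu\<close> and the substitution in T\<close>

lemma Zmu_0: "0 \<in> Zmu \<mu>"
  unfolding Zmu_def by (rule span_over_0)

lemma Zmu_add: "x \<in> Zmu \<mu> \<Longrightarrow> y \<in> Zmu \<mu> \<Longrightarrow> x + y \<in> Zmu \<mu>"
proof -
  have "module ((*) :: complex \<Rightarrow> complex \<Rightarrow> complex)"
    by unfold_locales (auto simp: algebra_simps)
  then show "x \<in> Zmu \<mu> \<Longrightarrow> y \<in> Zmu \<mu> \<Longrightarrow> x + y \<in> Zmu \<mu>"
    unfolding Zmu_def by (intro span_over_add Qmu_0 Qmu_add)
qed

text \<open>Horner's scheme: writing the polynomial as a + T q, each step multiplies the substituted
  q by T + c and adds a, so only sums and multiples by c of elements of \<open>Zmu\<close>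
  arise.\<close>

lemma pcompose_shift_in_ZmuT:
  assumes c: "\<And>z. z \<in> Zmu \<mu> \<Longrightarrow> c * z \<in> Zmu \<mu>" and p: "p \<in> ZmuT \<mu>"
  shows "pcompose p [:c, 1:] \<in> ZmuT \<mu>"
  using p
proof (induction p rule: pCons_induct)
  case (pCons a p)
  have "a \<in> Zmu \<mu>" and "coeff p i \<in> Zmu \<mu>" for i
    using pCons.prems by (auto simp: ZmuT_def dest: spec[of _ 0] spec[of _ "Suc i"])
  then have "\<And>i. coeff (pcompose p [:c, 1:]) i \<in> Zmu \<mu>"
    using pCons.IH by (simp add: ZmuT_def)
  with \<open>a \<in> Zmu \<mu>\<close> c show ?case
    by (auto simp: ZmuT_def pcompose_pCons coeff_pCons intro!: Zmu_add Zmu_0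
        simp del: coeff_pcompose_0 split: nat.splits)
qed simp

text \<open>Makes additivity, multiplicativity and invertibility of the substitution available from
  polynomial composition.\<close>

lemma varrho_star_eq_pcompose: "varrho_star \<mu> a b p = pcompose p [:c_const \<mu> a b, 1:]"
  by (simp add: varrho_star_def pcompose_altdef poly_altdef degree_map_poly coeff_map_poly)

lemma pcompose_shift_inverse: "pcompose (pcompose p [:c, 1:]) [:- c, 1:] = p"
  for p :: "complex poly"
  by (simp add: pcompose_assoc[symmetric] pcompose_pCons)

lemma varrho_star_inverse: "varrho_star \<mu> b a (varrho_star \<mu> a b p) = p"
proof -
  have "c_const \<mu> b a = - c_const \<mu> a b"
    by (simp add: c_const_def)
  then show ?thesis
    by (simp only: varrho_star_eq_pcompose pcompose_shift_inverse)
qed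

lemma linear_smult_iff:
  fixes f :: "complex poly \<Rightarrow> complex poly"
  shows "Vector_Spaces.linear smult smult f \<longleftrightarrow>
    (\<forall>p q. f (p + q) = f p + f q) \<and> (\<forall>c p. f (smult c p) = smult c (f p))"
proof -
  have "vector_space (smult :: complex \<Rightarrow> complex poly \<Rightarrow> complex poly)"
    by unfold_locales (auto simp: smult_add_right smult_add_left)
  then show ?thesis
    by (simp add: Vector_Spaces.linear_iff)
qed

section \<open>Regularizations and their dependence on the base point\<close>

text \<open>Common form of the specifications of \<open>zeta_star_T\<close> and
  \<open>zeta_sh_T\<close>, with \<open>y\<close> the element normalized to T, so that one change of
  base point argument serves both.\<close>

definition regularization ::
  "complex \<Rightarrow> 'a ncpoly set \<Rightarrow> 'a ncpoly set \<Rightarrow> ('a ncpoly \<Rightarrow> complex)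
    \<Rightarrow> ('a ncpoly \<Rightarrow> 'a ncpoly \<Rightarrow> 'a ncpoly) \<Rightarrow> 'a ncpoly \<Rightarrow> ('a ncpoly \<Rightarrow> complex poly) \<Rightarrow> bool" where
  "regularization \<mu> V V0 z mul y f \<longleftrightarrow>
     f \<in> V \<rightarrow>\<^sub>E ZmuT \<mu> \<and>
     linear_over (Qmu \<mu>) scale smult V f \<and>
     (\<forall>w\<in>V0. f w = [:z w:]) \<and>
     f y = [:0, 1:] \<and>
     (\<forall>u\<in>V. \<forall>v\<in>V. f (mul u v) = f u * f v)"

text \<open>From y' = y - (y - y') follows f y' = T - c, which the substitution sends to T.
  Composition is an algebra homomorphism fixing constants, so linearity, multiplicativity and the
  prescribed values on \<open>V0\<close> survive.\<close>

lemma regularization_shift: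
  assumes V: "\<And>u v. u \<in> V \<Longrightarrow> v \<in> V \<Longrightarrow> u + v \<in> V"
      "\<And>c v. c \<in> Qmu \<mu> \<Longrightarrow> v \<in> V \<Longrightarrow> scale c v \<in> V"
      "\<And>u v. u \<in> V \<Longrightarrow> v \<in> V \<Longrightarrow> mul u v \<in> V"
    and V0: "V0 \<subseteq> V" "y - y' \<in> V0" and y': "y' \<in> V" and c: "z (y - y') = c"
    and Zmu: "\<And>x. x \<in> Zmu \<mu> \<Longrightarrow> c * x \<in> Zmu \<mu>"
    and f: "regularization \<mu> V V0 z mul y f"
  shows "regularization \<mu> V V0 z mul y' (\<lambda>w\<in>V. pcompose (f w) [:c, 1:])"
proof -
  \<comment> \<open>\<open>linear_over\<close> speaks of sums and scalar multiples, so the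
    difference is rewritten as a sum.\<close>
  have "f ((y - y') + y') = f (y - y') + f y'"
    using f V0 y' unfolding regularization_def linear_over_def by blast
  moreover have "f y = [:0, 1:]" "f (y - y') = [:c:]"
    using f V0 c by (auto simp: regularization_def)
  ultimately have "f y' = [:0, 1:] - [:c:]"
    by (simp add: eq_diff_eq add.commute)
  then have "f y' = [:- c, 1:]"
    by simp
  then show ?thesis
    using f V V0 y' unfolding regularization_def linear_over_def
    by (auto simp: subset_iff pcompose_add pcompose_smult pcompose_mult pcompose_pCons
        intro!: pcompose_shift_in_ZmuT[OF Zmu])
qed

lemma zeta_star_T_eq:
  "zeta_star_T \<mu> m =
     the_map (regularization \<mu> (QY \<mu>) (QY0 \<mu>) (zeta_star \<mu>) (stuffle \<mu>) (word [(1, m)]))"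
  by (simp add: zeta_star_T_def regularization_def[abs_def])

lemma zeta_sh_T_eq:
  "zeta_sh_T \<mu> m = the_map (regularization \<mu> (QX1 \<mu>) (QX0 \<mu>) (zeta_sh \<mu>) shuffle (word [Y m]))"
  by (simp add: zeta_sh_T_def regularization_def[abs_def])

abbreviation star_reg :: "complex \<Rightarrow> rat \<Rightarrow> (yletter ncpoly \<Rightarrow> complex poly) \<Rightarrow> bool" where
  "star_reg \<mu> m \<equiv> regularization \<mu> (QY \<mu>) (QY0 \<mu>) (zeta_star \<mu>) (stuffle \<mu>) (word [(1, m)])"

abbreviation sh_reg :: "complex \<Rightarrow> rat \<Rightarrow> (xletter ncpoly \<Rightarrow> complex poly) \<Rightarrow> bool" where
  "sh_reg \<mu> m \<equiv> regularization \<mu> (QX1 \<mu>) (QX0 \<mu>) (zeta_sh \<mu>) shuffle (word [Y m])"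

text \<open>The condition inside \<open>zeta_sh\<close>, named in order to separate the genuine map
  from the junk value of \<open>the_map\<close>.\<close>

definition zeta_sh_spec :: "complex \<Rightarrow> (xletter ncpoly \<Rightarrow> complex) \<Rightarrow> bool" where
  "zeta_sh_spec \<mu> f \<longleftrightarrow>
     f \<in> QX0 \<mu> \<rightarrow>\<^sub>E Zmu \<mu> \<and>
     linear_over (Qmu \<mu>) scale (*) (QX0 \<mu>) f \<and>
     f (word []) = 1 \<and>
     (\<forall>w. admissible w \<longrightarrow> f (yx w) = zeta \<mu> w) \<and>
     (\<forall>p m m'. special p m m' \<longrightarrow>
        f (yx (p @ [(1, m)]) - yx (p @ [(1, m')])) = zeta_diff \<mu> p m m')"

lemma word_Y_eq_yx: "word [Y m] = yx [(1, m)]"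
  by (simp add: yx_def)

lemma word_Y_in_QX1: "m > 0 \<Longrightarrow> word [Y m] \<in> QX1 \<mu>"
  by (simp add: word_Y_eq_yx yx_in_QX1 positive_def)

lemma word_Nil_in_QX0: "word [] \<in> QX0 \<mu>"
  unfolding QX0_def by (intro span_over_base scale.module_axioms Qmu_1) auto

text \<open>If \<open>zeta_sh\<close> were the junk map, then \<open>f 1 = 0\<close> and \<open>T = f (1 \<cdot> y\<^sub>m) = 0\<close>.\<close>

lemma sh_reg_imp_zeta_sh_spec:
  assumes m: "m > 0" and f: "sh_reg \<mu> m f"
  shows "zeta_sh_spec \<mu> (zeta_sh \<mu>)"
proof -
  have eq: "zeta_sh \<mu> = the_map (zeta_sh_spec \<mu>)"
    by (simp add: zeta_sh_def zeta_sh_spec_def[abs_def])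
  have "\<exists>!f. zeta_sh_spec \<mu> f"
  proof (rule ccontr)
    assume "\<not> (\<exists>!f. zeta_sh_spec \<mu> f)"
    then have "f (word []) = 0"
      using f word_Nil_in_QX0 by (simp add: regularization_def eq the_map_junk)
    moreover have "f (shuffle (word []) (word [Y m])) = f (word []) * f (word [Y m])"
      using f word_Nil_in_QX0 QX0_subset_QX1 word_Y_in_QX1[OF m] unfolding regularization_def by blast
    moreover have "shuffle (word []) (word [Y m]) = word [Y m]"
      by (simp add: shuffle_def bilin_ext_word)
    moreover have "f (word [Y m]) = [:0, 1:]"
      using f by (simp add: regularization_def)
    ultimately show False
      by simp
  qed
  then show ?thesis
    unfolding eq by (rule the_map_spec)
qed

lemma QX0_add: "u \<in> QX0 \<mu> \<Longrightarrow> v \<in> QX0 \<mu> \<Longrightarrow> u + v \<in> QX0 \<mu>"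
  unfolding QX0_def by (intro span_over_add scale.module_axioms Qmu_0 Qmu_add)

lemma QX0_scale: "c \<in> Qmu \<mu> \<Longrightarrow> u \<in> QX0 \<mu> \<Longrightarrow> scale c u \<in> QX0 \<mu>"
  unfolding QX0_def by (intro span_over_scale scale.module_axioms Qmu_mult)

lemma QX0_0: "0 \<in> QX0 \<mu>"
  unfolding QX0_def by (rule span_over_0)

lemma word_Y_diff_in_QX0:
  assumes "a > 0" "b > 0"
  shows "word [Y a] - word [Y b] \<in> QX0 \<mu>"
proof (cases "a = b")
  case False
  with assms have "special [] a b"
    by (simp add: special_def positive_def)
  then show ?thesis
    unfolding QX0_def word_Y_eq_yx
    by (intro span_over_base scale.module_axioms Qmu_1 UnI2 CollectI exI[of _ "[]"] exI[of _ a] exI[of _ b]) simp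
qed (simp add: QX0_0)

lemma word_y1_diff_in_QY0:
  assumes "a > 0" "b > 0"
  shows "word [(1, a)] - word [(1, b)] \<in> QY0 \<mu>"
proof (cases "a = b")
  case False
  with assms have "special [] a b"
    by (simp add: special_def positive_def)
  then show ?thesis
    unfolding QY0_def
    by (intro span_over_base scale.module_axioms Qmu_1 UnI2 CollectI exI[of _ "[]"] exI[of _ a] exI[of _ b]) simp
qed (simp add: QY0_def span_over_0)

lemma zeta_sh_Y_diff:
  assumes \<mu>: "Re \<mu> > 0" and a: "a > 0" and b: "b > 0" and z: "zeta_sh_spec \<mu> (zeta_sh \<mu>)"
  shows "zeta_sh \<mu> (word [Y a] - word [Y b]) = c_const \<mu> a b"
proof (cases "a = b")
  \<comment> \<open>A special triple has distinct last entries, so equal indices are settled by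
    additivity at 0.\<close>
  case True
  have "zeta_sh \<mu> (0 + 0) = zeta_sh \<mu> 0 + zeta_sh \<mu> 0"
    using z QX0_0 unfolding zeta_sh_spec_def linear_over_def by blast
  then show ?thesis
    by (simp add: True c_const_def)
next
  case False
  then have "special [] a b"
    using a b by (simp add: special_def positive_def)
  then have "zeta_sh \<mu> (yx ([] @ [(1, a)]) - yx ([] @ [(1, b)])) = zeta_diff \<mu> [] a b"
    using z unfolding zeta_sh_spec_def by blast
  then show ?thesis
    by (simp add: word_Y_eq_yx zeta_diff_Nil[OF \<mu> a b])
qed

text \<open>Every generator of \<open>Zmu\<close> is a prescribed value of \<open>zeta_sh\<close>,
  and the image of a linear map is closed under combinations. Elements of \<open>Zmu\<close> thereby
  become values that a shuffle regularization can multiply.\<close>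

lemma Zmu_subset_zeta_sh_image:
  assumes z: "zeta_sh_spec \<mu> (zeta_sh \<mu>)"
  shows "Zmu \<mu> \<subseteq> zeta_sh \<mu> ` QX0 \<mu>"
  unfolding Zmu_def
proof (rule span_over_subset)
  have add: "zeta_sh \<mu> (u + v) = zeta_sh \<mu> u + zeta_sh \<mu> v" if "u \<in> QX0 \<mu>" "v \<in> QX0 \<mu>" for u v
    using z that unfolding zeta_sh_spec_def linear_over_def by blast
  have scale: "zeta_sh \<mu> (scale c u) = c * zeta_sh \<mu> u" if "c \<in> Qmu \<mu>" "u \<in> QX0 \<mu>" for c u
    using z that unfolding zeta_sh_spec_def linear_over_def by blast
  show "x + y \<in> zeta_sh \<mu> ` QX0 \<mu>" if "x \<in> zeta_sh \<mu> ` QX0 \<mu>" "y \<in> zeta_sh \<mu> ` QX0 \<mu>" for x y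
    using that by (auto simp flip: add intro!: imageI QX0_add)
  show "c * x \<in> zeta_sh \<mu> ` QX0 \<mu>" if "c \<in> Qmu \<mu>" "x \<in> zeta_sh \<mu> ` QX0 \<mu>" for c x
    using that by (auto simp flip: scale intro!: imageI QX0_scale)
  show "0 \<in> zeta_sh \<mu> ` QX0 \<mu>"
    using add[OF QX0_0 QX0_0] QX0_0 by (intro image_eqI[of _ _ 0]) auto
  have "1 \<in> zeta_sh \<mu> ` QX0 \<mu>"
    using z word_Nil_in_QX0 unfolding zeta_sh_spec_def by (metis image_eqI)
  moreover have "zeta \<mu> w \<in> zeta_sh \<mu> ` QX0 \<mu>" if "admissible w" for w
  proof (rule image_eqI)
    show "zeta \<mu> w = zeta_sh \<mu> (yx w)"
      using z that unfolding zeta_sh_spec_def by simp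
    show "yx w \<in> QX0 \<mu>"
      unfolding QX0_def using that by (intro span_over_base scale.module_axioms Qmu_1) auto
  qed
  moreover have "zeta_diff \<mu> p m m' \<in> zeta_sh \<mu> ` QX0 \<mu>" if "special p m m'" for p m m'
  proof (rule image_eqI)
    show "zeta_diff \<mu> p m m' = zeta_sh \<mu> (yx (p @ [(1, m)]) - yx (p @ [(1, m')]))"
      using z that unfolding zeta_sh_spec_def by simp
    show "yx (p @ [(1, m)]) - yx (p @ [(1, m')]) \<in> QX0 \<mu>"
      unfolding QX0_def using that by (intro span_over_base scale.module_axioms Qmu_1) blast
  qed
  ultimately show "{1} \<union> {zeta \<mu> w | w. admissible w} \<union> {zeta_diff \<mu> p m m' | p m m'. special p m m'}
      \<subseteq> zeta_sh \<mu> ` QX0 \<mu>"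
    by blast
qed

text \<open>If x is the value at u, then c x is the constant polynomial f(d) f(u), where d is the
  difference of the two \<open>Y\<close> letters. It equals the value of f at the shuffle of d and
  u, which has coefficients in \<open>Zmu\<close>.\<close>

lemma sh_reg_imp_Zmu_mult_c_const:
  assumes \<mu>: "Re \<mu> > 0" and m: "m > 0" and f: "sh_reg \<mu> m f" and ab: "a > 0" "b > 0"
    and x: "x \<in> Zmu \<mu>"
  shows "c_const \<mu> a b * x \<in> Zmu \<mu>"
proof -
  let ?d = "word [Y a] - word [Y b]"
  have z: "zeta_sh_spec \<mu> (zeta_sh \<mu>)"
    using sh_reg_imp_zeta_sh_spec[OF m f] .
  obtain u where u: "u \<in> QX0 \<mu>" "x = zeta_sh \<mu> u"
    using x Zmu_subset_zeta_sh_image[OF z] by blast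
  have d: "?d \<in> QX0 \<mu>"
    using word_Y_diff_in_QX0[OF ab] .
  then have "f (shuffle ?d u) = f ?d * f u" "shuffle ?d u \<in> QX1 \<mu>"
    using f u QX0_subset_QX1 shuffle_in_QX1 unfolding regularization_def by blast+
  then have "f ?d * f u \<in> ZmuT \<mu>"
    using f unfolding regularization_def by (metis PiE_mem)
  moreover have "f ?d * f u = [:c_const \<mu> a b * x:]"
    using f u d zeta_sh_Y_diff[OF \<mu> ab z] by (simp add: regularization_def)
  ultimately show ?thesis
    by (metis ZmuT_def mem_Collect_eq coeff_pCons_0)
qed

text \<open>The existence of f itself supplies both the value of \<open>zeta_sh\<close> on the
  difference of letters and the stability of \<open>Zmu\<close>.\<close>

lemma sh_reg_shift:
  assumes \<mu>: "Re \<mu> > 0" and ab: "a > 0" "b > 0" and f: "sh_reg \<mu> a f"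
  shows "sh_reg \<mu> b (\<lambda>w\<in>QX1 \<mu>. varrho_star \<mu> a b (f w))"
  unfolding varrho_star_eq_pcompose
proof (rule regularization_shift[OF _ _ _ _ _ _ _ _ f])
  show "zeta_sh \<mu> (word [Y a] - word [Y b]) = c_const \<mu> a b"
    using zeta_sh_Y_diff[OF \<mu> ab sh_reg_imp_zeta_sh_spec[OF ab(1) f]] .
  show "c_const \<mu> a b * x \<in> Zmu \<mu>" if "x \<in> Zmu \<mu>" for x
    using sh_reg_imp_Zmu_mult_c_const[OF \<mu> ab(1) f ab that] .
qed (use ab in \<open>auto intro: shuffle_in_QX1 word_Y_in_QX1 word_Y_diff_in_QX0 subsetD[OF QX0_subset_QX1]\<close>,
     auto simp: QX1_eq intro: ncpolys_over_add ncpolys_over_scale)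

lemma word_y1_in_QY: "m > 0 \<Longrightarrow> word [(1, m)] \<in> QY \<mu>"
  by (simp add: QY_eq ncpolys_over_word positive_def)

text \<open>Stability of \<open>Zmu\<close> enters as a hypothesis, to be supplied from the shuffle
  side.\<close>

lemma star_reg_shift:
  assumes \<mu>: "Re \<mu> > 0" and ab: "a > 0" "b > 0" and f: "star_reg \<mu> a f"
    and Zmu: "\<And>x. x \<in> Zmu \<mu> \<Longrightarrow> c_const \<mu> a b * x \<in> Zmu \<mu>"
  shows "star_reg \<mu> b (\<lambda>w\<in>QY \<mu>. varrho_star \<mu> a b (f w))"
  unfolding varrho_star_eq_pcompose
proof (rule regularization_shift[OF _ _ _ _ _ _ _ _ f])
  show "zeta_star \<mu> (word [(1, a)] - word [(1, b)]) = c_const \<mu> a b"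
    using zeta_star_y1_diff[OF \<mu> ab] .
qed (use ab Zmu in \<open>auto intro: stuffle_in_QY word_y1_in_QY[unfolded One_nat_def]
       word_y1_diff_in_QY0[unfolded One_nat_def] subsetD[OF QY0_subset_QY]\<close>,
     auto simp: QY_eq intro: ncpolys_over_add ncpolys_over_scale)

text \<open>Restriction to V loses nothing for an extensional map, so the two changes of base point
  are inverse to each other.\<close>

lemma varrho_star_restrict_inverse:
  assumes "g \<in> extensional V"
  shows "(\<lambda>w\<in>V. varrho_star \<mu> a b ((\<lambda>w\<in>V. varrho_star \<mu> b a (g w)) w)) = g"
  using assms by (auto simp: fun_eq_iff restrict_def extensional_def varrho_star_inverse)

lemma regularization_extensional: "regularization \<mu> V V0 z mul y f \<Longrightarrow> f \<in> extensional V"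
  by (simp add: regularization_def PiE_def)

lemma regularization_normalized: "regularization \<mu> V V0 z mul y f \<Longrightarrow> f y = [:0, 1:]"
  by (simp add: regularization_def)

lemma ex1_sh_reg_shift:
  assumes \<mu>: "Re \<mu> > 0" and ab: "a > 0" "b > 0" and ex1: "\<exists>!f. sh_reg \<mu> a f"
  shows "\<exists>!f. sh_reg \<mu> b f"
  by (rule ex1_transfer[OF ex1, where F = "\<lambda>f. \<lambda>w\<in>QX1 \<mu>. varrho_star \<mu> a b (f w)"
        and G = "\<lambda>f. \<lambda>w\<in>QX1 \<mu>. varrho_star \<mu> b a (f w)"];
      intro sh_reg_shift[OF \<mu>] ab varrho_star_restrict_inverse)
     (auto intro: regularization_extensional)

lemma zeta_sh_T_shift:
  assumes \<mu>: "Re \<mu> > 0" and ab: "a > 0" "b > 0" and ex1: "\<exists>!f. sh_reg \<mu> a f" and w: "w \<in> QX1 \<mu>"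
  shows "zeta_sh_T \<mu> b w = varrho_star \<mu> a b (zeta_sh_T \<mu> a w)"
proof -
  have "zeta_sh_T \<mu> b = (\<lambda>w\<in>QX1 \<mu>. varrho_star \<mu> a b (zeta_sh_T \<mu> a w))"
    unfolding zeta_sh_T_eq
    by (intro the_map_eqI ex1_sh_reg_shift[OF \<mu> ab ex1] sh_reg_shift[OF \<mu> ab] the_map_spec[OF ex1])
  then show ?thesis
    using w by simp
qed

text \<open>The hypothesis on \<open>Zmu\<close> is stated for all pairs because the shift from a to
  b and its inverse are both used.\<close>

lemma ex1_star_reg_shift:
  assumes \<mu>: "Re \<mu> > 0" and ab: "a > 0" "b > 0" and ex1: "\<exists>!f. star_reg \<mu> a f"
    and Zmu: "\<And>x a b. x \<in> Zmu \<mu> \<Longrightarrow> a > 0 \<Longrightarrow> b > 0 \<Longrightarrow> c_const \<mu> a b * x \<in> Zmu \<mu>"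
  shows "\<exists>!f. star_reg \<mu> b f"
  by (rule ex1_transfer[OF ex1, where F = "\<lambda>f. \<lambda>w\<in>QY \<mu>. varrho_star \<mu> a b (f w)"
        and G = "\<lambda>f. \<lambda>w\<in>QY \<mu>. varrho_star \<mu> b a (f w)"];
      intro star_reg_shift[OF \<mu>] ab varrho_star_restrict_inverse)
     (auto intro: regularization_extensional Zmu ab)

lemma zeta_star_T_shift:
  assumes \<mu>: "Re \<mu> > 0" and ab: "a > 0" "b > 0" and ex1: "\<exists>!f. star_reg \<mu> a f"
    and Zmu: "\<And>x a b. x \<in> Zmu \<mu> \<Longrightarrow> a > 0 \<Longrightarrow> b > 0 \<Longrightarrow> c_const \<mu> a b * x \<in> Zmu \<mu>"
    and w: "w \<in> QY \<mu>"
  shows "zeta_star_T \<mu> b w = varrho_star \<mu> a b (zeta_star_T \<mu> a w)"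
proof -
  have "zeta_star_T \<mu> b = (\<lambda>w\<in>QY \<mu>. varrho_star \<mu> a b (zeta_star_T \<mu> a w))"
    unfolding zeta_star_T_eq
    by (intro the_map_eqI ex1_star_reg_shift[OF \<mu> ab ex1 Zmu] star_reg_shift[OF \<mu> ab] the_map_spec[OF ex1] Zmu ab)
  then show ?thesis
    using w by simp
qed

section \<open>Comparison maps and their conjugation\<close>

definition comparison :: "complex \<Rightarrow> rat \<Rightarrow> rat \<Rightarrow> (complex poly \<Rightarrow> complex poly) \<Rightarrow> bool" where
  "comparison \<mu> a b f \<longleftrightarrow> Vector_Spaces.linear smult smult f \<and>
     (\<forall>w\<in>QY \<mu>. zeta_sh_T \<mu> b (phi w) = f (zeta_star_T \<mu> a w))"

lemma rho_eq: "rho \<mu> a b = the_map (comparison \<mu> a b)"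
  by (simp add: rho_def comparison_def[abs_def])

text \<open>With the shuffle side identically zero, the zero map is a comparison map. Either it is
  the only one, or uniqueness fails and \<open>rho\<close> takes its junk value, again zero.\<close>

lemma rho_no_sh_reg:
  assumes "\<not> (\<exists>!f. sh_reg \<mu> b f)"
  shows "rho \<mu> a b = (\<lambda>_. 0)"
proof -
  have "comparison \<mu> a b (\<lambda>_. 0)"
    using assms by (simp add: comparison_def linear_smult_iff zeta_sh_T_eq the_map_junk)
  then show ?thesis
    unfolding rho_eq by (metis the_map_eqI the_map_junk)
qed

text \<open>With the star side identically zero, a comparison map f would satisfy T = f 0 = 0 when
  tested on the letter of weight one and index b. So none exists and \<open>rho\<close> is the junk
  map.\<close>

lemma rho_no_star_reg:
  assumes b: "b > 0" and sh: "\<exists>!f. sh_reg \<mu> b f" and star: "\<not> (\<exists>!f. star_reg \<mu> a f)"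
  shows "rho \<mu> a b = (\<lambda>_. 0)"
proof -
  have "\<not> comparison \<mu> a b f" for f
  proof
    assume f: "comparison \<mu> a b f"
    then have "f 0 = 0"
      unfolding comparison_def linear_smult_iff by (metis smult_0_left)
    with f have "zeta_sh_T \<mu> b (phi (word [(1, b)])) = 0"
      using word_y1_in_QY[OF b] star by (simp add: comparison_def zeta_star_T_eq the_map_junk)
    moreover have "phi (word [(1, b)]) = word [Y b]"
      by (simp add: phi_def lin_ext_word word_Y_eq_yx)
    moreover have "zeta_sh_T \<mu> b (word [Y b]) = [:0, 1:]"
      unfolding zeta_sh_T_eq by (rule regularization_normalized[OF the_map_spec[OF sh]])
    ultimately show False
      by simp
  qed
  then show ?thesis
    unfolding rho_eq by (intro the_map_junk) blast
qed

lemma varrho_star_add: "varrho_star \<mu> a b (p + q) = varrho_star \<mu> a b p + varrho_star \<mu> a b q"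
  by (simp add: varrho_star_eq_pcompose pcompose_add)

lemma varrho_star_smult: "varrho_star \<mu> a b (smult c p) = smult c (varrho_star \<mu> a b p)"
  by (simp add: varrho_star_eq_pcompose pcompose_smult)

text \<open>The inner substitution carries the star regularization from m1' back to m1, f compares
  it with the shuffle one at m2, and the outer substitution moves the result to m2'.\<close>

lemma comparison_shift:
  assumes \<mu>: "Re \<mu> > 0" and m: "m1 > 0" "m1' > 0" "m2 > 0" "m2' > 0"
    and sh: "\<exists>!f. sh_reg \<mu> m2 f" and star: "\<exists>!f. star_reg \<mu> m1 f"
    and f: "comparison \<mu> m1 m2 f"
  shows "comparison \<mu> m1' m2' (\<lambda>p. varrho_star \<mu> m2 m2' (f (varrho_star \<mu> m1' m1 p)))"
proof -
  note Zmu = sh_reg_imp_Zmu_mult_c_const[OF \<mu> m(3) the_map_spec[OF sh]]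
  have "zeta_sh_T \<mu> m2' (phi w) = varrho_star \<mu> m2 m2' (f (varrho_star \<mu> m1' m1 (zeta_star_T \<mu> m1' w)))"
    if w: "w \<in> QY \<mu>" for w
    using f w
    by (simp add: zeta_sh_T_shift[OF \<mu> m(3,4) sh phi_in_QX1[OF w]]
        zeta_star_T_shift[OF \<mu> m(1,2) star Zmu w] varrho_star_inverse comparison_def)
  then show ?thesis
    using f by (simp add: comparison_def linear_smult_iff varrho_star_add varrho_star_smult)
qed

theorem theorem1p6:
  fixes \<mu> :: complex and m1 m1' m2 m2' :: rat
  assumes "Re \<mu> > 0"
    and "m1 > 0" and "m1' > 0" and "m2 > 0" and "m2' > 0"
  shows "rho \<mu> m1' m2' \<circ> varrho_star \<mu> m1 m1' = varrho_sh \<mu> m2 m2' \<circ> rho \<mu> m1 m2"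
proof (cases "(\<exists>!f. sh_reg \<mu> m2 f) \<and> (\<exists>!f. star_reg \<mu> m1 f)")
  case True
  then have sh: "\<exists>!f. sh_reg \<mu> m2 f" and star: "\<exists>!f. star_reg \<mu> m1 f"
    by blast+
  note Zmu = sh_reg_imp_Zmu_mult_c_const[OF assms(1,4) the_map_spec[OF sh]]
  have sh': "\<exists>!f. sh_reg \<mu> m2' f"
    using ex1_sh_reg_shift[OF assms(1,4,5) sh] .
  have star': "\<exists>!f. star_reg \<mu> m1' f"
    using ex1_star_reg_shift[OF assms(1-3) star Zmu] .
  note fwd = comparison_shift[OF assms sh star]
  note bwd = comparison_shift[OF assms(1,3,2,5,4) sh' star']
  \<comment> \<open>\<open>?F\<close> and \<open>?G\<close> are inverse bijections between the
    comparison maps for the two pairs of base points.\<close>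
  let ?F = "\<lambda>f p. varrho_star \<mu> m2 m2' (f (varrho_star \<mu> m1' m1 p))"
  let ?G = "\<lambda>f p. varrho_star \<mu> m2' m2 (f (varrho_star \<mu> m1 m1' p))"
  show ?thesis
  proof (cases "\<exists>!f. comparison \<mu> m1 m2 f")
    case True
    have "\<exists>!f. comparison \<mu> m1' m2' f"
      by (rule ex1_transfer[OF True, where F = ?F and G = ?G]; (rule fwd bwd)?) (auto simp: varrho_star_inverse)
    then have "rho \<mu> m1' m2' = (\<lambda>p. varrho_star \<mu> m2 m2' (rho \<mu> m1 m2 (varrho_star \<mu> m1' m1 p)))"
      unfolding rho_eq by (intro the_map_eqI fwd the_map_spec[OF True])
    then show ?thesis
      by (auto simp: varrho_star_inverse varrho_sh_def)
  next
    case False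
    have "\<not> (\<exists>!f. comparison \<mu> m1' m2' f)"
    proof
      assume ex1: "\<exists>!f. comparison \<mu> m1' m2' f"
      have "\<exists>!f. comparison \<mu> m1 m2 f"
        by (rule ex1_transfer[OF ex1, where F = ?G and G = ?F]; (rule fwd bwd)?) (auto simp: varrho_star_inverse)
      with False show False ..
    qed
    with False show ?thesis
      \<comment> \<open>Both \<open>rho\<close> are the junk map, and the substitution sends 0 to
        0.\<close>
      by (auto simp: rho_eq the_map_junk varrho_sh_def varrho_star_eq_pcompose)
  qed
next
  case False
  have "rho \<mu> m1 m2 = (\<lambda>_. 0)"
    using False rho_no_sh_reg rho_no_star_reg[OF assms(4)] by blast
  moreover have "rho \<mu> m1' m2' = (\<lambda>_. 0)"
  proof (cases "\<exists>!f. sh_reg \<mu> m2' f")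
    case sh': True
    note Zmu = sh_reg_imp_Zmu_mult_c_const[OF assms(1,5) the_map_spec[OF sh']]
    \<comment> \<open>Otherwise both regularizations could be shifted back from m2' and m1' to m2
      and m1, contradicting the case assumption.\<close>
    have "\<not> (\<exists>!f. star_reg \<mu> m1' f)"
      using False ex1_sh_reg_shift[OF assms(1,5,4) sh'] ex1_star_reg_shift[OF assms(1,3,2) _ Zmu]
      by blast
    then show ?thesis
      using rho_no_star_reg[OF assms(5) sh'] by blast
  qed (rule rho_no_sh_reg)
  ultimately show ?thesis
    by (auto simp: varrho_sh_def varrho_star_eq_pcompose)
qed

end
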